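(* Let $\lambda^{(m)}$ and $\lambda'^{(m)}$ be two arbitrary $m$-partitions of size $n$. Then the representation $V_{\lambda^{(m)}}\hat{\otimes}V_{\lambda'^{(m)}}$ of $H(m,1,n)$ is isomorphic to the direct sum of $\dim(V_{\lambda'^{(m)}})$ copies of $V_{\lambda^{(m)}}$: $$V_{\lambda^{(m)}}\hat{\otimes}V_{\lambda'^{(m)}}\cong \dim(V_{\lambda'^{(m)}})\ V_{\lambda^{(m)}} .$$
   Context: Parameters. Let $m,n\ge 1$. Either $K=\mathbb{C}(q,v_1,\dots,v_m)$ with $q,v_1,\dots,v_m$ indeterminates, or $K=\mathbb{C}$ and $q,v_1,\dots,v_m\in\mathbb{C}$, $q\neq0$, satisfy: $1+q^2+\dots+q^{2N}\neq0$ for all non-negative integers $N<n$; $q^{2i}v_j-v_k\neq0$ for all $i,j,k$ with $j\neq k$ and $-n<i<n$; $v_j\neq0$ for all $j=1,\dots,m$. Cyclotomic Hecke algebra. $H(m,1,n)$ is the associative unital $K$-algebra generated by $\tau,\sigma_1,\dots,\sigma_{n-1}$ with defining relations $\sigma_i\sigma_{i+1}\sigma_i=\sigma_{i+1}\sigma_i\sigma_{i+1}$; $\sigma_i\sigma_j=\sigma_j\sigma_i$ if $|i-j|>1$; $\tau\sigma_1\tau\sigma_1=\sigma_1\tau\sigma_1\tau$; $\tau\sigma_i=\sigma_i\tau$ for $i>1$; $\sigma_i^2=(q-q^{-1})\sigma_i+1$; $(\tau-v_1)\cdots(\tau-v_m)=0$. Tableaux. An $m$-partition of $n$ is an $m$-tuple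 $\lambda^{(m)}=(\lambda_1,\dots,\lambda_m)$ of partitions (Young diagrams) with $|\lambda_1|+\dots+|\lambda_m|=n$. Its $m$-nodes are the nodes of the diagrams together with the index $k$ of the diagram. The content of the $m$-node in row $r$ and column $s$ of the $k$-th diagram is $v_kq^{2(s-r)}$. A standard $m$-tableau of shape $\lambda^{(m)}$ is a bijective filling of the $m$-nodes with $1,\dots,n$ such that in every diagram the numbers increase along rows (to the right) and columns (downwards). $c(X_{\lambda^{(m)}}|i)$ is the content of the $m$-node carrying $i$ in $X_{\lambda^{(m)}}$. $X_{\lambda^{(m)}}^{s_i}$ is obtained by exchanging $i$ and $i+1$. Representations $V_{\lambda^{(m)}}$. $V_{\lambda^{(m)}}$ is the $H(m,1,n)$-module with $K$-basis $\{\mathcal{X}_{\lambda^{(m)}}\}$ indexed by the standard $m$-tableaux $X_{\lambda^{(m)}}$ of shape $\lambda^{(m)}$, and action (with $c^{(i)}:=c(X_{\lambda^{(m)}}|i)$) $$\tau(\mathcal{X}_{\lambda^{(m)}})=c^{(1)}\mathcal{X}_{\lambda^{(m)}},\qquad \sigma_i(\mathcal{X}_{\lambda^{(m)}})=\frac{(q-q^{-1})c^{(i+1)}}{c^{(i+1)}-c^{(i)}}\mathcal{X}_{\lambda^{(m)}}+\frac{qc^{(i+1)}-q^{-1}c^{(i)}}{c^{(i+1)}-c^{(i)}}\mathcal{X}_{\lambda^{(m)}}^{s_i},$$ where $\mathcal{X}_{\lambda^{(m)}}^{s_i}$ is the basis vector of $X_{\lambda^{(m)}}^{s_i}$ if this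 $m$-tableau is standard and $0$ otherwise. The underlying vector space is denoted $U_{\lambda^{(m)}}$. The product $\hat{\otimes}$. $V_{\lambda^{(m)}}\hat{\otimes}V_{\lambda'^{(m)}}$ is the $H(m,1,n)$-module with underlying space $U_{\lambda^{(m)}}\otimes U_{\lambda'^{(m)}}$ obtained by moving elements of $H(m,1,n)$ to the right through the generators $\mathcal{X}_{\lambda^{(m)}}$ by the rules $(\sigma_i+\frac{(q-q^{-1})c^{(i+1)}}{c^{(i)}-c^{(i+1)}})\mathcal{X}_{\lambda^{(m)}}=\mathcal{X}_{\lambda^{(m)}}^{s_i}(\sigma_i+\frac{(q-q^{-1})c^{(i)}}{c^{(i+1)}-c^{(i)}})$, $(\tau-c^{(1)})\mathcal{X}_{\lambda^{(m)}}=0$, and then letting them act on $V_{\lambda'^{(m)}}$; explicitly, for $w\in V_{\lambda'^{(m)}}$, $$\tau(\mathcal{X}_{\lambda^{(m)}}\otimes w)=c^{(1)}\,\mathcal{X}_{\lambda^{(m)}}\otimes w,\qquad \sigma_i(\mathcal{X}_{\lambda^{(m)}}\otimes w)=\frac{(q-q^{-1})c^{(i+1)}}{c^{(i+1)}-c^{(i)}}\,\mathcal{X}_{\lambda^{(m)}}\otimes w+\mathcal{X}_{\lambda^{(m)}}^{s_i}\otimes\Bigl(\sigma_i(w)+\frac{(q-q^{-1})c^{(i)}}{c^{(i+1)}-c^{(i)}}\,w\Bigr).$$ These formulas define an $H(m,1,n)$-module structure. *)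

theory Defs
  imports
    Complex_Main
    "HOL-Library.Function_Algebras"
    "HOL-Library.Poly_Mapping"
    "HOL-Computational_Algebra.Polynomial"
    "HOL-Computational_Algebra.Fraction_Field"
    "HOL-Combinatorics.Transposition"
    "HOL-Algebra.QuotRing"
begin

text \<open>The set of diagram indices \<open>{1,\<dots>,m}\<close> is a finite linearly ordered type \<open>'m\<close>
  (so \<open>m = CARD('m) \<ge> 1\<close>).\<close>

definition admissible :: "nat \<Rightarrow> 'k::field \<Rightarrow> ('m \<Rightarrow> 'k) \<Rightarrow> bool" where
  "admissible n q v \<longleftrightarrow>
     q \<noteq> 0 \<and>
     (\<forall>N<n. (\<Sum>i\<le>N. q ^ (2 * i)) \<noteq> 0) \<and>
     (\<forall>(i::int) j k. j \<noteq> k \<and> - int n < i \<and> i < int n \<longrightarrow> q powi (2 * i) * v j - v k \<noteq> 0) \<and>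
     (\<forall>j. v j \<noteq> 0)"

text \<open>The field of rational functions over \<open>\<complex>\<close> in the indeterminates \<open>q\<close> and \<open>v\<^sub>j\<close>, realised as
  the fraction field of \<open>\<complex>[v][q]\<close>: an element of \<open>('m \<Rightarrow>\<^sub>0 nat) \<Rightarrow>\<^sub>0 complex\<close> is a polynomial in the
  variables \<open>v\<^sub>j\<close>, given by its coefficients on exponent vectors.\<close>

type_synonym 'm ratfun = "(('m \<Rightarrow>\<^sub>0 nat) \<Rightarrow>\<^sub>0 complex) poly fract"

definition indet_q :: "'m::linorder ratfun" where
  "indet_q = Fract [:0, 1:] 1"

definition indet_v :: "'m::linorder \<Rightarrow> 'm ratfun" where
  "indet_v j = Fract [: Poly_Mapping.single (Poly_Mapping.single j 1) 1 :] 1"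

datatype hgen = Tau | Sigma nat

definition hgens :: "nat \<Rightarrow> hgen set" where
  "hgens n = insert Tau {Sigma i | i. 1 \<le> i \<and> i < n}"

text \<open>The free monoid, written additively so that the convolution product on \<open>_ \<Rightarrow>\<^sub>0 'k\<close> turns
  finitely supported functions on it into the free associative algebra.\<close>

datatype 'g fmon = FMon (letters: "'g list")

instantiation fmon :: (type) monoid_add
begin

definition zero_fmon :: "'a fmon" where
  "zero_fmon = FMon []"

definition plus_fmon :: "'a fmon \<Rightarrow> 'a fmon \<Rightarrow> 'a fmon" where
  "plus_fmon x y = FMon (letters x @ letters y)"

instance
  by standard (simp_all add: zero_fmon_def plus_fmon_def)

end

type_synonym 'k freealg = "hgen fmon \<Rightarrow>\<^sub>0 'k"

definition gen :: "hgen \<Rightarrow> 'k::field freealg" where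
  "gen g = Poly_Mapping.single (FMon [g]) 1"

definition scal :: "'k::field \<Rightarrow> 'k freealg" where
  "scal c = Poly_Mapping.single 0 c"

abbreviation "\<tau> \<equiv> gen Tau"
abbreviation "\<sigma> i \<equiv> gen (Sigma i)"

definition free_alg :: "nat \<Rightarrow> ('k::field freealg) ring" where
  "free_alg n =
     \<lparr>carrier = {x. \<forall>w\<in>Poly_Mapping.keys x. set (letters w) \<subseteq> hgens n},
      mult = (*), one = 1, zero = 0, add = (+)\<rparr>"

definition hecke_relators ::
    "nat \<Rightarrow> 'k::field \<Rightarrow> ('m::{finite,linorder} \<Rightarrow> 'k) \<Rightarrow> 'k freealg set" where
  "hecke_relators n q v =
     {\<sigma> i * \<sigma> (i + 1) * \<sigma> i - \<sigma> (i + 1) * \<sigma> i * \<sigma> (i + 1) | i. 1 \<le> i \<and> i + 1 < n}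
   \<union> {\<sigma> i * \<sigma> j - \<sigma> j * \<sigma> i | i j.
        1 \<le> i \<and> i < n \<and> 1 \<le> j \<and> j < n \<and> \<bar>int i - int j\<bar> > 1}
   \<union> (if 1 < n then {\<tau> * \<sigma> 1 * \<tau> * \<sigma> 1 - \<sigma> 1 * \<tau> * \<sigma> 1 * \<tau>} else {})
   \<union> {\<tau> * \<sigma> i - \<sigma> i * \<tau> | i. 1 < i \<and> i < n}
   \<union> {\<sigma> i * \<sigma> i - (scal (q - inverse q) * \<sigma> i + 1) | i. 1 \<le> i \<and> i < n}
   \<union> {prod_list (map (\<lambda>j. \<tau> - scal (v j)) (sorted_list_of_set UNIV))}"

definition hecke_ideal ::
    "nat \<Rightarrow> 'k::field \<Rightarrow> ('m::{finite,linorder} \<Rightarrow> 'k) \<Rightarrow> 'k freealg set" where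
  "hecke_ideal n q v = genideal (free_alg n) (hecke_relators n q v)"

definition hecke ::
    "nat \<Rightarrow> 'k::field \<Rightarrow> ('m::{finite,linorder} \<Rightarrow> 'k) \<Rightarrow> ('k freealg set) ring" where
  "hecke n q v = free_alg n Quot hecke_ideal n q v"

definition hecke_class ::
    "nat \<Rightarrow> 'k::field \<Rightarrow> ('m::{finite,linorder} \<Rightarrow> 'k) \<Rightarrow> 'k freealg \<Rightarrow> 'k freealg set" where
  "hecke_class n q v x = a_r_coset (free_alg n) (hecke_ideal n q v) x"

text \<open>The vector space with basis a finite set \<open>B\<close> is realised as the space of \<open>'k\<close>-valued functions
  vanishing outside \<open>B\<close>.\<close>

definition fscale :: "'k::field \<Rightarrow> ('b \<Rightarrow> 'k) \<Rightarrow> 'b \<Rightarrow> 'k" where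
  "fscale c f = (\<lambda>b. c * f b)"

interpretation fun_vs: vector_space "fscale :: 'k::field \<Rightarrow> ('b \<Rightarrow> 'k) \<Rightarrow> 'b \<Rightarrow> 'k"
  by standard (auto simp: fscale_def fun_eq_iff algebra_simps)

definition bvec :: "'b \<Rightarrow> 'b \<Rightarrow> 'k::field" where
  "bvec b = (\<lambda>x. if x = b then 1 else 0)"

definition tens :: "('a \<Rightarrow> 'k::field) \<Rightarrow> ('b \<Rightarrow> 'k) \<Rightarrow> 'a \<times> 'b \<Rightarrow> 'k" where
  "tens u w = (\<lambda>(x, y). u x * w y)"

record (overloaded) ('k, 'b) hmod =
  space :: "('b \<Rightarrow> 'k) set"
  act :: "'k freealg set \<Rightarrow> ('b \<Rightarrow> 'k) \<Rightarrow> 'b \<Rightarrow> 'k"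

definition is_hmod ::
    "nat \<Rightarrow> 'k::field \<Rightarrow> ('m::{finite,linorder} \<Rightarrow> 'k) \<Rightarrow> ('k, 'b) hmod \<Rightarrow> bool" where
  "is_hmod n q v M \<longleftrightarrow>
     fun_vs.subspace (space M) \<and>
     (\<forall>h\<in>carrier (hecke n q v). \<forall>x\<in>space M. act M h x \<in> space M) \<and>
     (\<forall>h\<in>carrier (hecke n q v). \<forall>x\<in>space M. \<forall>y\<in>space M.
        act M h (x + y) = act M h x + act M h y) \<and>
     (\<forall>h\<in>carrier (hecke n q v). \<forall>x\<in>space M. \<forall>c.
        act M h (fscale c x) = fscale c (act M h x)) \<and>
     (\<forall>h\<in>carrier (hecke n q v). \<forall>h'\<in>carrier (hecke n q v). \<forall>x\<in>space M.
        act M (h \<oplus>\<^bsub>hecke n q v\<^esub> h') x = act M h x + act M h' x \<and>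
        act M (h \<otimes>\<^bsub>hecke n q v\<^esub> h') x = act M h (act M h' x)) \<and>
     (\<forall>x\<in>space M. act M \<one>\<^bsub>hecke n q v\<^esub> x = x) \<and>
     (\<forall>x\<in>space M. \<forall>c. act M (hecke_class n q v (scal c)) x = fscale c x)"

definition hmod_iso ::
    "nat \<Rightarrow> 'k::field \<Rightarrow> ('m::{finite,linorder} \<Rightarrow> 'k) \<Rightarrow> ('k, 'a) hmod \<Rightarrow> ('k, 'b) hmod \<Rightarrow> bool"
  where
  "hmod_iso n q v M N \<longleftrightarrow>
     is_hmod n q v M \<and> is_hmod n q v N \<and>
     (\<exists>\<phi>. bij_betw \<phi> (space M) (space N) \<and>
        (\<forall>x\<in>space M. \<forall>y\<in>space M. \<phi> (x + y) = \<phi> x + \<phi> y) \<and>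
        (\<forall>x\<in>space M. \<forall>c. \<phi> (fscale c x) = fscale c (\<phi> x)) \<and>
        (\<forall>h\<in>carrier (hecke n q v). \<forall>x\<in>space M. \<phi> (act M h x) = act N h (\<phi> x)))"

definition copies :: "nat \<Rightarrow> ('k::field, 'b) hmod \<Rightarrow> ('k, nat \<times> 'b) hmod" where
  "copies d M =
     \<lparr>space = {F. (\<forall>i<d. (\<lambda>b. F (i, b)) \<in> space M) \<and> (\<forall>i\<ge>d. \<forall>b. F (i, b) = 0)},
      act = (\<lambda>h F (i, b). if i < d then act M h (\<lambda>b'. F (i, b')) b else 0)\<rparr>"

text \<open>The extension of an action \<open>T\<close> of the generators on the space with basis \<open>B\<close> to the Hecke
  algebra: a class acts through a representative. When \<open>T\<close> satisfies the defining relations on that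
  space, the choice of the representative does not matter.\<close>

definition free_act ::
    "(hgen \<Rightarrow> ('b \<Rightarrow> 'k) \<Rightarrow> 'b \<Rightarrow> 'k) \<Rightarrow> 'k::field freealg \<Rightarrow> ('b \<Rightarrow> 'k) \<Rightarrow> 'b \<Rightarrow> 'k" where
  "free_act T x f =
     (\<Sum>w\<in>Poly_Mapping.keys x. fscale (Poly_Mapping.lookup x w) (foldr T (letters w) f))"

definition gen_hmod ::
    "'b set \<Rightarrow> (hgen \<Rightarrow> ('b \<Rightarrow> 'k) \<Rightarrow> 'b \<Rightarrow> 'k) \<Rightarrow> ('k::field, 'b) hmod" where
  "gen_hmod B T =
     \<lparr>space = {f. \<forall>b. b \<notin> B \<longrightarrow> f b = 0},
      act = (\<lambda>h. free_act T (SOME x. x \<in> h))\<rparr>"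

type_synonym 'm node = "'m \<times> nat \<times> nat"
type_synonym 'm filling = "'m node \<Rightarrow> nat"

definition is_partition :: "nat list \<Rightarrow> bool" where
  "is_partition p \<longleftrightarrow> sorted_wrt (\<ge>) p \<and> 0 \<notin> set p"

definition is_mpartition :: "nat \<Rightarrow> ('m::finite \<Rightarrow> nat list) \<Rightarrow> bool" where
  "is_mpartition n lam \<longleftrightarrow>
     (\<forall>k. is_partition (lam k)) \<and> (\<Sum>k\<in>UNIV. sum_list (lam k)) = n"

definition nodes :: "('m \<Rightarrow> nat list) \<Rightarrow> 'm node set" where
  "nodes lam = {(k, r, s). 1 \<le> r \<and> r \<le> length (lam k) \<and> 1 \<le> s \<and> s \<le> lam k ! (r - 1)}"

text \<open>A filling is extended by 0 outside the shape, so that fillings of a shape are determined by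
  their entries.\<close>

definition std_tableaux :: "nat \<Rightarrow> ('m \<Rightarrow> nat list) \<Rightarrow> 'm filling set" where
  "std_tableaux n lam =
     {X. bij_betw X (nodes lam) {1..n} \<and>
         (\<forall>p. p \<notin> nodes lam \<longrightarrow> X p = 0) \<and>
         (\<forall>k r s s'. (k, r, s) \<in> nodes lam \<and> (k, r, s') \<in> nodes lam \<and> s < s'
            \<longrightarrow> X (k, r, s) < X (k, r, s')) \<and>
         (\<forall>k r r' s. (k, r, s) \<in> nodes lam \<and> (k, r', s) \<in> nodes lam \<and> r < r'
            \<longrightarrow> X (k, r, s) < X (k, r', s))}"

definition node_of :: "('m \<Rightarrow> nat list) \<Rightarrow> 'm filling \<Rightarrow> nat \<Rightarrow> 'm node" where
  "node_of lam X i = inv_into (nodes lam) X i"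

definition swap :: "nat \<Rightarrow> 'm filling \<Rightarrow> 'm filling" where
  "swap i X = Transposition.transpose i (i + 1) \<circ> X"

definition std_vec :: "nat \<Rightarrow> ('m \<Rightarrow> nat list) \<Rightarrow> 'm filling \<Rightarrow> 'm filling \<Rightarrow> 'k::field" where
  "std_vec n lam X = (if X \<in> std_tableaux n lam then bvec X else 0)"

fun diag :: "'m node \<Rightarrow> int" where
  "diag (k, r, s) = int s - int r"

definition content :: "'k::field \<Rightarrow> ('m \<Rightarrow> 'k) \<Rightarrow> 'm node \<Rightarrow> 'k" where
  "content q v p = v (fst p) * q powi (2 * diag p)"

text \<open>With \<open>c\<close>, \<open>c'\<close> the contents of the nodes \<open>p\<close>, \<open>p'\<close> occupied by \<open>i\<close>, \<open>i + 1\<close>, the coefficients are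
  \<open>(q - q\<^sup>-\<^sup>1) c' / (c' - c)\<close>, \<open>(q c' - q\<^sup>-\<^sup>1 c) / (c' - c)\<close> and \<open>(q - q\<^sup>-\<^sup>1) c / (c' - c)\<close>.
  The conditions on the parameters permit \<open>q\<^sup>2 = 1\<close>, where these expressions have the form \<open>0/0\<close> for
  two nodes of the same diagram. For such nodes, with \<open>d = diag p' - diag p\<close>, the common factor
  \<open>q - q\<^sup>-\<^sup>1\<close> cancels and leaves \<open>q\<^sup>d/[d]\<close>, \<open>[d + 1]/[d]\<close> and \<open>q\<^sup>-\<^sup>d/[d]\<close>, where
  \<open>[d] = (q\<^sup>d - q\<^sup>-\<^sup>d)/(q - q\<^sup>-\<^sup>1)\<close>; the values at \<open>q\<^sup>2 = 1\<close> are those of these continuous extensions,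
  where \<open>[d]\<close> becomes \<open>d q\<^sup>d\<^sup>-\<^sup>1\<close>.\<close>

definition confluent :: "'k::field \<Rightarrow> 'm node \<Rightarrow> 'm node \<Rightarrow> bool" where
  "confluent q p p' \<longleftrightarrow> q ^ 2 = 1 \<and> fst p = fst p'"

definition coef_diag :: "'k::field \<Rightarrow> ('m \<Rightarrow> 'k) \<Rightarrow> 'm node \<Rightarrow> 'm node \<Rightarrow> 'k" where
  "coef_diag q v p p' =
     (if confluent q p p' then q / of_int (diag p' - diag p)
      else (q - inverse q) * content q v p' / (content q v p' - content q v p))"

definition coef_swap :: "'k::field \<Rightarrow> ('m \<Rightarrow> 'k) \<Rightarrow> 'm node \<Rightarrow> 'm node \<Rightarrow> 'k" where
  "coef_swap q v p p' =
     (if confluent q p p' then q * of_int (diag p' - diag p + 1) / of_int (diag p' - diag p)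
      else (q * content q v p' - inverse q * content q v p) / (content q v p' - content q v p))"

definition coef_shift :: "'k::field \<Rightarrow> ('m \<Rightarrow> 'k) \<Rightarrow> 'm node \<Rightarrow> 'm node \<Rightarrow> 'k" where
  "coef_shift q v p p' =
     (if confluent q p p' then q / of_int (diag p' - diag p)
      else (q - inverse q) * content q v p / (content q v p' - content q v p))"

fun V_op ::
    "nat \<Rightarrow> 'k::field \<Rightarrow> ('m \<Rightarrow> 'k) \<Rightarrow> ('m \<Rightarrow> nat list) \<Rightarrow> hgen \<Rightarrow>
     ('m filling \<Rightarrow> 'k) \<Rightarrow> 'm filling \<Rightarrow> 'k" where
  "V_op n q v lam Tau f =
     (\<Sum>X\<in>std_tableaux n lam. fscale (f X) (fscale (content q v (node_of lam X 1)) (bvec X)))"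
| "V_op n q v lam (Sigma i) f =
     (\<Sum>X\<in>std_tableaux n lam. fscale (f X)
        (let p = node_of lam X i; p' = node_of lam X (i + 1)
         in fscale (coef_diag q v p p') (bvec X)
            + fscale (coef_swap q v p p') (std_vec n lam (swap i X))))"

definition V_mod ::
    "nat \<Rightarrow> 'k::field \<Rightarrow> ('m \<Rightarrow> 'k) \<Rightarrow> ('m \<Rightarrow> nat list) \<Rightarrow> ('k, 'm filling) hmod" where
  "V_mod n q v lam = gen_hmod (std_tableaux n lam) (V_op n q v lam)"

text \<open>Every \<open>F\<close> in the tensor product is the sum of the \<open>bvec X \<otimes> w\<close> with \<open>w = F (X, _)\<close>.\<close>

fun T_op ::
    "nat \<Rightarrow> 'k::field \<Rightarrow> ('m \<Rightarrow> 'k) \<Rightarrow> ('m \<Rightarrow> nat list) \<Rightarrow> ('m \<Rightarrow> nat list) \<Rightarrow> hgen \<Rightarrow>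
     ('m filling \<times> 'm filling \<Rightarrow> 'k) \<Rightarrow> 'm filling \<times> 'm filling \<Rightarrow> 'k" where
  "T_op n q v lam lam' Tau F =
     (\<Sum>X\<in>std_tableaux n lam. let w = (\<lambda>Y. F (X, Y))
        in fscale (content q v (node_of lam X 1)) (tens (bvec X) w))"
| "T_op n q v lam lam' (Sigma i) F =
     (\<Sum>X\<in>std_tableaux n lam. let w = (\<lambda>Y. F (X, Y));
                                  p = node_of lam X i; p' = node_of lam X (i + 1)
        in fscale (coef_diag q v p p') (tens (bvec X) w)
           + tens (std_vec n lam (swap i X))
               (V_op n q v lam' (Sigma i) w + fscale (coef_shift q v p p') w))"

definition T_mod ::
    "nat \<Rightarrow> 'k::field \<Rightarrow> ('m \<Rightarrow> 'k) \<Rightarrow> ('m \<Rightarrow> nat list) \<Rightarrow> ('m \<Rightarrow> nat list) \<Rightarrow>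
     ('k, 'm filling \<times> 'm filling) hmod" where
  "T_mod n q v lam lam' =
     gen_hmod (std_tableaux n lam \<times> std_tableaux n lam') (T_op n q v lam lam')"

end

theory Submission
  imports Defs "HOL-Computational_Algebra.Polynomial_Factorial"
begin

text \<open>The twisted product differs from a sum of copies of \<open>V\<^sub>\<lambda>\<close> only in that the passage from a basis
  vector \<open>X\<close> to \<open>swap i X\<close> applies the Baxterised operator \<open>\<sigma>\<^sub>i + e\<close> to \<open>V\<^sub>\<lambda>\<^sub>'\<close>, with a scalar \<open>e\<close>
  depending on the contents of \<open>i\<close> and \<open>i + 1\<close>, where \<open>V\<^sub>\<lambda>\<close> has the scalar \<open>b\<close>.
  These operators are invertible between standard tableaux and satisfy the
  Yang-Baxter equation, so there are invertible operators \<open>h\<^sub>X\<close> on \<open>V\<^sub>\<lambda>\<^sub>'\<close> with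
  \<open>h (swap i X) \<circ> (\<sigma>\<^sub>i + e) = b \<cdot> h X\<close>. Then \<open>X \<otimes> w \<mapsto> X \<otimes> h\<^sub>X w\<close> is the isomorphism. It also carries the
  defining relations over from \<open>V\<^sub>\<lambda>\<close>, where they are checked directly, to the twisted product.\<close>

section \<open>Modules over the cyclotomic Hecke algebra\<close>

text \<open>The equation for \<open>h\<close> is a gauge condition along the edges of the graph of
  standard tableaux, so the question is whether it closes up around cycles. One standard tableau is
  fixed, \<open>h\<close> is the identity there, and walking towards it makes the graph acyclic. By
  the diamond lemma only squares (distant exchanges) and hexagons (adjacent exchanges) have to
  close; going back along an edge is settled by the quadratic relation. An exchange that leaves the
  standard tableaux has no off-diagonal term in either module and imposes nothing on
  \<open>h\<close>. The parameter conditions enter twice. Entries at most two apart never share a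
  diagonal of one diagram, and this keeps the denominators in a braid relation nonzero. The
  numerator of the swap coefficient vanishes only for nodes whose order is forced in every standard
  tableau, so each edge carries an invertible operator. For \<open>q ^ 2 = 1\<close> contents no
  longer tell the nodes of one diagram apart; the coefficient identities are then proved with
  diagonals in place of contents.\<close>

lemma poly_mapping_additive_induct [case_names zero single add]:
  assumes "P 0" and "\<And>w c. P (Poly_Mapping.single w c)" and "\<And>x y. P x \<Longrightarrow> P y \<Longrightarrow> P (x + y)"
  shows "P x"
proof (induction x rule: update_induct)
  case const
  show ?case by fact
next
  case (update f a b)
  have "Poly_Mapping.update a b f = f + Poly_Mapping.single a b"
    using update.hyps
    by (intro poly_mapping_eqI)
       (auto simp: lookup_update lookup_add lookup_single in_keys_iff when_def)
  then show ?case using assms update.IH by simp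
qed

locale linear_ops =
  fixes T :: "hgen \<Rightarrow> ('b \<Rightarrow> 'k::field) \<Rightarrow> 'b \<Rightarrow> 'k"
  assumes T_add: "T g (f + f') = T g f + T g f'"
    and T_scale: "T g (fscale c f) = fscale c (T g f)"
begin

lemma free_act_superset:
  assumes "finite F" "Poly_Mapping.keys x \<subseteq> F"
  shows "free_act T x f = (\<Sum>w\<in>F. fscale (Poly_Mapping.lookup x w) (foldr T (letters w) f))"
  unfolding free_act_def using assms
  by (intro sum.mono_neutral_left) (auto simp: in_keys_iff)

lemma free_act_zero [simp]: "free_act T 0 f = 0"
  by (simp add: free_act_def)

lemma free_act_add: "free_act T (x + y) f = free_act T x f + free_act T y f"
proof -
  let ?F = "Poly_Mapping.keys x \<union> Poly_Mapping.keys y"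
  have "Poly_Mapping.keys (x + y) \<subseteq> ?F" by (rule Poly_Mapping.keys_add)
  then show ?thesis
    by (simp add: free_act_superset[of ?F] lookup_add fun_vs.scale_left_distrib sum.distrib)
qed

lemma free_act_diff: "free_act T (x - y) f = free_act T x f - free_act T y f"
  using free_act_add[of "x - y" y f] by (simp add: algebra_simps)

lemma free_act_single: "free_act T (Poly_Mapping.single w c) f = fscale c (foldr T (letters w) f)"
  by (simp add: free_act_superset[of "{w}"])

lemma foldr_add: "foldr T ws (f + f') = foldr T ws f + foldr T ws f'"
  by (induction ws) (simp_all only: T_add foldr.simps o_apply id_apply)

lemma foldr_scale: "foldr T ws (fscale c f) = fscale c (foldr T ws f)"
  by (induction ws) (simp_all only: T_scale foldr.simps o_apply id_apply)

lemma free_act_add_right: "free_act T x (f + f') = free_act T x f + free_act T x f'"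
  by (simp add: free_act_def foldr_add fun_vs.scale_right_distrib sum.distrib)

lemma free_act_scale_right: "free_act T x (fscale c f) = fscale c (free_act T x f)"
  by (simp add: free_act_def foldr_scale fun_vs.scale_sum_right mult.commute)

lemma free_act_zero_right [simp]: "free_act T x 0 = 0"
  using free_act_scale_right[of x 0 0] by simp

text \<open>Both sides are additive in \<open>x\<close> and in \<open>y\<close>, which leaves scaled
  words; there concatenation of letter lists turns into composition of operators.\<close>

lemma free_act_mult: "free_act T (x * y) f = free_act T x (free_act T y f)"
proof (induction x rule: poly_mapping_additive_induct)
  case (single w c)
  show ?case
  proof (induction y rule: poly_mapping_additive_induct)
    case (single w' c')
    show ?case
      by (simp add: mult_single free_act_single plus_fmon_def foldr_scale)
  qed (simp_all only: distrib_left free_act_add free_act_add_right free_act_zero free_act_zero_right mult_zero_right)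
qed (simp_all only: distrib_right free_act_add free_act_zero mult_zero_left)

lemma free_act_scal: "free_act T (scal c) f = fscale c f"
  by (simp add: scal_def free_act_single zero_fmon_def)

lemma free_act_one: "free_act T 1 f = f"
  using free_act_scal[of 1] by (simp add: scal_def flip: single_one)

lemma free_act_gen: "free_act T (gen g) f = T g f"
  by (simp add: gen_def free_act_single)

lemmas free_act_simps =
  free_act_add free_act_diff free_act_mult free_act_scal free_act_one free_act_gen

end

section \<open>The free algebra as a ring\<close>

lemma free_alg_mult_closed:
  "x \<in> carrier (free_alg n) \<Longrightarrow> y \<in> carrier (free_alg n) \<Longrightarrow> x * y \<in> carrier (free_alg n)"
  using Poly_Mapping.keys_mult[of x y] by (fastforce simp: free_alg_def plus_fmon_def)

lemma free_alg_add_closed: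
  "x \<in> carrier (free_alg n) \<Longrightarrow> y \<in> carrier (free_alg n) \<Longrightarrow> x + y \<in> carrier (free_alg n)"
  using Poly_Mapping.keys_add[of x y] by (fastforce simp: free_alg_def)

lemma free_alg_uminus_closed: "x \<in> carrier (free_alg n) \<Longrightarrow> - x \<in> carrier (free_alg n)"
  by (auto simp: free_alg_def in_keys_iff)

lemma free_alg_diff_closed:
  "x \<in> carrier (free_alg n) \<Longrightarrow> y \<in> carrier (free_alg n) \<Longrightarrow> x - y \<in> carrier (free_alg n)"
  using free_alg_add_closed[of x n "- y"] free_alg_uminus_closed[of y n] by simp

lemma free_alg_scal_closed: "scal c \<in> carrier (free_alg n)"
  by (auto simp: free_alg_def scal_def zero_fmon_def split: if_splits)

lemma free_alg_one_closed: "1 \<in> carrier (free_alg n)"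
  using free_alg_scal_closed[of 1 n] by (simp add: scal_def flip: single_one)

lemma free_alg_gen_closed: "g \<in> hgens n \<Longrightarrow> gen g \<in> carrier (free_alg n)"
  by (auto simp: free_alg_def gen_def split: if_splits)

lemmas free_alg_closed = free_alg_mult_closed free_alg_add_closed free_alg_uminus_closed
  free_alg_diff_closed free_alg_scal_closed free_alg_one_closed free_alg_gen_closed

lemma ring_free_alg: "ring (free_alg n :: ('k::field freealg) ring)"
proof (rule ringI)
  show "abelian_group (free_alg n :: ('k::field freealg) ring)"
  proof (rule abelian_groupI)
    show "\<zero>\<^bsub>free_alg n\<^esub> \<in> carrier (free_alg n :: ('k freealg) ring)"
      by (simp add: free_alg_def)
  next
    fix x :: "'k freealg" assume x: "x \<in> carrier (free_alg n)"
    then show "\<exists>y\<in>carrier (free_alg n). y \<oplus>\<^bsub>free_alg n\<^esub> x = \<zero>\<^bsub>free_alg n\<^esub>"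
      by (intro bexI[of _ "- x"]) (auto simp: free_alg_uminus_closed, simp add: free_alg_def)
  next
    fix x y :: "'k freealg" assume "x \<in> carrier (free_alg n)" "y \<in> carrier (free_alg n)"
    then show "x \<oplus>\<^bsub>free_alg n\<^esub> y \<in> carrier (free_alg n)"
      using free_alg_add_closed by (simp add: free_alg_def)
  qed (auto simp: free_alg_def algebra_simps)
  show "monoid (free_alg n :: ('k::field freealg) ring)"
  proof (rule monoidI)
    fix x y :: "'k freealg" assume "x \<in> carrier (free_alg n)" "y \<in> carrier (free_alg n)"
    then show "x \<otimes>\<^bsub>free_alg n\<^esub> y \<in> carrier (free_alg n)"
      using free_alg_mult_closed by (simp add: free_alg_def)
  next
    show "\<one>\<^bsub>free_alg n\<^esub> \<in> carrier (free_alg n :: ('k freealg) ring)"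
      using free_alg_one_closed by (simp add: free_alg_def)
  qed (auto simp: free_alg_def algebra_simps)
qed (auto simp: free_alg_def algebra_simps)

lemma hecke_relators_closed: "hecke_relators n q v \<subseteq> carrier (free_alg n)"
proof -
  have *: "prod_list (map (\<lambda>j. \<tau> - scal (v j)) js) \<in> carrier (free_alg n)" for js
    by (induction js) (auto intro!: free_alg_closed simp: hgens_def)
  show ?thesis
    unfolding hecke_relators_def using *
    by (auto intro!: free_alg_closed simp: hgens_def)
qed

section \<open>Representations from operators satisfying the defining relations\<close>

definition supported :: "'b set \<Rightarrow> ('b \<Rightarrow> 'k::field) set" where
  "supported B = {f. \<forall>b. b \<notin> B \<longrightarrow> f b = 0}"

lemma space_gen_hmod [simp]: "space (gen_hmod B T) = supported B"
  by (simp add: gen_hmod_def supported_def)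

lemma subspace_supported: "fun_vs.subspace (supported B)"
  by (auto simp: fun_vs.subspace_def supported_def fscale_def)

text \<open>The relations are demanded only on \<open>supported B\<close>: the seminormal operators
  annihilate functions vanishing on the tableaux, but the unit in the quadratic relation does
  not.\<close>

locale hecke_rep = linear_ops T
  for n :: nat and q :: "'k::field" and v :: "'m::{finite,linorder} \<Rightarrow> 'k" and B :: "'b set"
    and T :: "hgen \<Rightarrow> ('b \<Rightarrow> 'k) \<Rightarrow> 'b \<Rightarrow> 'k" +
  assumes preserves: "g \<in> hgens n \<Longrightarrow> f \<in> supported B \<Longrightarrow> T g f \<in> supported B"
    and relators: "x \<in> hecke_relators n q v \<Longrightarrow> f \<in> supported B \<Longrightarrow> free_act T x f = 0"
begin

lemma free_act_supported:
  assumes "x \<in> carrier (free_alg n)" "f \<in> supported B"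
  shows "free_act T x f \<in> supported B"
proof -
  have "foldr T ws f \<in> supported B" if "set ws \<subseteq> hgens n" for ws
    using that by (induction ws) (auto simp: assms preserves)
  then show ?thesis
    unfolding free_act_def using assms
    by (intro fun_vs.subspace_sum fun_vs.subspace_scale subspace_supported)
       (auto simp: free_alg_def)
qed

definition annih :: "'k freealg set" where
  "annih = {x \<in> carrier (free_alg n). \<forall>f\<in>supported B. free_act T x f = 0}"

text \<open>Closure under right multiplication is where \<open>preserves\<close> enters:
  \<open>a * x\<close> kills \<open>f\<close> because \<open>x\<close> maps \<open>f\<close> back
  into \<open>supported B\<close>, on which \<open>a\<close> acts as 0.\<close>

lemma ideal_annih: "ideal annih (free_alg n)"
proof (rule idealI[OF ring_free_alg])
  interpret R: ring "free_alg n :: ('k freealg) ring" by (rule ring_free_alg)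
  show "subgroup annih (add_monoid (free_alg n))"
  proof (rule R.add.subgroupI)
    show "annih \<subseteq> carrier (free_alg n)" by (auto simp: annih_def)
    show "annih \<noteq> {}"
    proof -
      have "\<zero>\<^bsub>free_alg n\<^esub> \<in> annih"
        using R.zero_closed by (auto simp: annih_def free_alg_def)
      then show ?thesis by blast
    qed
  next
    fix x assume x: "x \<in> annih"
    have "\<ominus>\<^bsub>free_alg n\<^esub> x = - x"
      using x by (intro R.minus_equality) (auto simp: annih_def free_alg_closed, simp add: free_alg_def)
    moreover have "- x \<in> annih"
      using x free_act_diff[of 0 x] by (auto simp: annih_def free_alg_uminus_closed)
    ultimately show "\<ominus>\<^bsub>free_alg n\<^esub> x \<in> annih" by simp
  next
    fix x y assume "x \<in> annih" "y \<in> annih"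
    then have "x + y \<in> annih" by (auto simp: annih_def free_alg_closed free_act_add)
    then show "x \<oplus>\<^bsub>free_alg n\<^esub> y \<in> annih" by (simp add: free_alg_def)
  qed
next
  fix a x :: "'k freealg" assume "a \<in> annih" "x \<in> carrier (free_alg n)"
  then have "x * a \<in> annih" "a * x \<in> annih"
    by (auto simp: annih_def free_alg_closed free_act_mult free_act_supported)
  then show "x \<otimes>\<^bsub>free_alg n\<^esub> a \<in> annih" "a \<otimes>\<^bsub>free_alg n\<^esub> x \<in> annih"
    by (simp_all add: free_alg_def)
qed

lemma hecke_ideal_subset: "hecke_ideal n q v \<subseteq> annih"
  unfolding hecke_ideal_def
  by (rule ring.genideal_minimal[OF ring_free_alg ideal_annih])
     (use hecke_relators_closed relators in \<open>auto simp: annih_def\<close>)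

lemma ideal_hecke_ideal: "ideal (hecke_ideal n q v) (free_alg n)"
  unfolding hecke_ideal_def
  by (rule ring.genideal_ideal[OF ring_free_alg hecke_relators_closed])

lemma carrier_hecke: "h \<in> carrier (hecke n q v) \<longleftrightarrow> (\<exists>x\<in>carrier (free_alg n). h = hecke_class n q v x)"
  by (auto simp: hecke_def hecke_class_def FactRing_def A_RCOSETS_def' a_r_coset_def r_coset_def)

text \<open>The representative picked by \<open>SOME\<close> differs from \<open>x\<close> by an
  element of the ideal, and the ideal lies in \<open>annih\<close>.\<close>

lemma act_hecke_class:
  assumes x: "x \<in> carrier (free_alg n)" and f: "f \<in> supported B"
  shows "act (gen_hmod B T) (hecke_class n q v x) f = free_act T x f"
proof -
  interpret I: ideal "hecke_ideal n q v" "free_alg n" by (rule ideal_hecke_ideal)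
  let ?h = "hecke_class n q v x"
  have "x \<in> ?h" unfolding hecke_class_def using x by (rule I.a_rcos_self)
  then have "(SOME y. y \<in> ?h) \<in> ?h" by (rule someI)
  then obtain a where "a \<in> hecke_ideal n q v" "(SOME y. y \<in> ?h) = a + x"
    unfolding hecke_class_def a_r_coset_def r_coset_def by (auto simp: free_alg_def)
  moreover from this have "free_act T a f = 0"
    using hecke_ideal_subset f by (auto simp: annih_def)
  ultimately show ?thesis by (simp add: gen_hmod_def free_act_add)
qed

lemma
  assumes "x \<in> carrier (free_alg n)" "y \<in> carrier (free_alg n)"
  shows hecke_class_add: "hecke_class n q v x \<oplus>\<^bsub>hecke n q v\<^esub> hecke_class n q v y = hecke_class n q v (x + y)"
    and hecke_class_mult: "hecke_class n q v x \<otimes>\<^bsub>hecke n q v\<^esub> hecke_class n q v y = hecke_class n q v (x * y)"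
proof -
  interpret I: ideal "hecke_ideal n q v" "free_alg n" by (rule ideal_hecke_ideal)
  show "hecke_class n q v x \<oplus>\<^bsub>hecke n q v\<^esub> hecke_class n q v y = hecke_class n q v (x + y)"
    using ring_hom_add[OF I.rcos_ring_hom assms] by (simp add: hecke_def hecke_class_def, simp add: free_alg_def)
  show "hecke_class n q v x \<otimes>\<^bsub>hecke n q v\<^esub> hecke_class n q v y = hecke_class n q v (x * y)"
    using ring_hom_mult[OF I.rcos_ring_hom assms] by (simp add: hecke_def hecke_class_def, simp add: free_alg_def)
qed

lemma one_hecke: "\<one>\<^bsub>hecke n q v\<^esub> = hecke_class n q v 1"
  by (simp add: hecke_def hecke_class_def FactRing_def) (simp add: free_alg_def)

lemma is_hmod_gen_hmod: "is_hmod n q v (gen_hmod B T)"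
  unfolding is_hmod_def one_hecke
  by (auto simp: carrier_hecke act_hecke_class subspace_supported free_act_supported
      fun_vs.subspace_add[OF subspace_supported] fun_vs.subspace_scale[OF subspace_supported]
      free_act_add_right free_act_scale_right hecke_class_add hecke_class_mult free_act_simps free_alg_closed)

lemma is_hmod_copies: "is_hmod n q v (copies d (gen_hmod B T))"
proof -
  let ?M = "gen_hmod B T"
  note M = is_hmod_gen_hmod[unfolded is_hmod_def]
  have z: "act ?M h 0 = 0" if "h \<in> carrier (hecke n q v)" for h
    using that by (auto simp: carrier_hecke act_hecke_class fun_vs.subspace_0[OF subspace_supported])
  have add: "(\<lambda>b. (F + G) (i, b)) = (\<lambda>b. F (i, b)) + (\<lambda>b. G (i, b))"
    and scale: "(\<lambda>b. fscale c F (i, b)) = fscale c (\<lambda>b. F (i, b))"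
    for F G :: "nat \<times> 'b \<Rightarrow> 'k" and i c
    by (auto simp: fscale_def fun_eq_iff)
  have sp: "space (copies d ?M) = {F. (\<forall>i<d. (\<lambda>b. F (i, b)) \<in> supported B) \<and> (\<forall>i\<ge>d. \<forall>b. F (i, b) = 0)}"
    by (simp add: copies_def)
  have ac: "act (copies d ?M) h F (i, b) = (if i < d then act ?M h (\<lambda>b. F (i, b)) b else 0)" for h F i b
    by (simp add: copies_def)
  \<comment> \<open>Reduces each module law for the copies to the components below \<open>d\<close>;
    the others are 0 on both sides.\<close>
  have lift: "act (copies d ?M) h F = G"
    if "\<And>i. i < d \<Longrightarrow> act ?M h (\<lambda>b. F (i, b)) = (\<lambda>b. G (i, b))" "\<And>i b. i \<ge> d \<Longrightarrow> G (i, b) = 0" for h F G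
    using that by (auto simp: fun_eq_iff ac)
  show ?thesis
    unfolding is_hmod_def
  proof (intro conjI ballI allI)
    show "fun_vs.subspace (space (copies d ?M))"
      unfolding fun_vs.subspace_def sp
      by (auto simp: supported_def fscale_def)
  next
    fix h F assume "h \<in> carrier (hecke n q v)" "F \<in> space (copies d ?M)"
    then show "act (copies d ?M) h F \<in> space (copies d ?M)"
      using M unfolding sp by (auto simp: ac)
  next
    fix h F G assume "h \<in> carrier (hecke n q v)" "F \<in> space (copies d ?M)" "G \<in> space (copies d ?M)"
    then show "act (copies d ?M) h (F + G) = act (copies d ?M) h F + act (copies d ?M) h G"
      using M by (intro lift) (simp_all add: sp ac add, simp only: plus_fun_def)
  next
    fix h F c assume "h \<in> carrier (hecke n q v)" "F \<in> space (copies d ?M)"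
    then show "act (copies d ?M) h (fscale c F) = fscale c (act (copies d ?M) h F)"
      using M by (intro lift) (auto simp: sp ac scale, auto simp: fscale_def ac)
  next
    fix h h' F assume *: "h \<in> carrier (hecke n q v)" "h' \<in> carrier (hecke n q v)" "F \<in> space (copies d ?M)"
    then show "act (copies d ?M) (h \<oplus>\<^bsub>hecke n q v\<^esub> h') F = act (copies d ?M) h F + act (copies d ?M) h' F"
      using M by (intro lift) (auto simp: sp ac plus_fun_def)
    from * show "act (copies d ?M) (h \<otimes>\<^bsub>hecke n q v\<^esub> h') F = act (copies d ?M) h (act (copies d ?M) h' F)"
      using M by (intro lift) (auto simp: sp ac)
  next
    fix F assume "F \<in> space (copies d ?M)"
    then show "act (copies d ?M) \<one>\<^bsub>hecke n q v\<^esub> F = F"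
      using M by (intro lift) (auto simp: sp)
  next
    fix F c assume "F \<in> space (copies d ?M)"
    then show "act (copies d ?M) (hecke_class n q v (scal c)) F = fscale c F"
      using M by (intro lift) (auto simp: sp scale, auto simp: fscale_def)
  qed
qed

end

lemma free_act_intertwine:
  assumes "linear_ops T" "linear_ops T'"
    and pres: "\<And>g f. g \<in> hgens n \<Longrightarrow> f \<in> supported B \<Longrightarrow> T g f \<in> supported B"
    and lin: "Vector_Spaces.linear fscale fscale \<phi>"
    and comm: "\<And>g f. g \<in> hgens n \<Longrightarrow> f \<in> supported B \<Longrightarrow> \<phi> (T g f) = T' g (\<phi> f)"
    and x: "x \<in> carrier (free_alg n)" and f: "f \<in> supported B"
  shows "\<phi> (free_act T x f) = free_act T' x (\<phi> f)"
proof -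
  interpret \<phi>: Vector_Spaces.linear fscale fscale \<phi> by fact
  \<comment> \<open>The two claims go through the induction together, since \<open>comm\<close> is
    available only on \<open>supported B\<close>.\<close>
  have "foldr T ws f \<in> supported B \<and> \<phi> (foldr T ws f) = foldr T' ws (\<phi> f)" if "set ws \<subseteq> hgens n" for ws
    using that by (induction ws) (auto simp: f pres comm)
  then show ?thesis
    unfolding free_act_def using x by (auto simp: free_alg_def \<phi>.sum \<phi>.scale intro!: sum.cong)
qed

section \<open>Coefficients and standard tableaux\<close>

lemma inverse_eq_self_if_square_one: "(q::'k::field) ^ 2 = 1 \<Longrightarrow> inverse q = q"
  by (rule inverse_unique) (simp add: power2_eq_square)

text \<open>Two nodes are separated when the denominator occurring in their three coefficients is nonzero;
  in the confluent case it is the difference of the diagonals.\<close>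

definition separated :: "'k::field \<Rightarrow> ('m \<Rightarrow> 'k) \<Rightarrow> 'm node \<Rightarrow> 'm node \<Rightarrow> bool" where
  "separated q v p p' \<longleftrightarrow>
     (if confluent q p p' then (of_int (diag p) :: 'k) \<noteq> of_int (diag p')
      else content q v p \<noteq> content q v p')"

lemma confluent_commute: "confluent q p p' \<longleftrightarrow> confluent q p' p"
  by (auto simp: confluent_def)

lemma separated_commute: "separated q v p p' \<longleftrightarrow> separated q v p' p"
  by (auto simp: separated_def confluent_commute)

text \<open>Expresses the third coefficient through the first with the nodes exchanged, so that
  identities for \<open>coef_diag\<close> also serve the twisted product.\<close>

lemma coef_shift_eq: "separated q v p p' \<Longrightarrow> coef_shift q v p p' = - coef_diag q v p' p"
  by (auto simp: separated_def coef_shift_def coef_diag_def confluent_commute[of q p']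
      divide_simps) (auto simp: algebra_simps)

text \<open>The trace of the two-by-two block of a generator on \<open>X\<close> and
  \<open>swap i X\<close>, that is, the sum of the eigenvalues \<open>q\<close> and
  \<open>- inverse q\<close>.\<close>

lemma coef_diag_add:
  assumes "separated q v p p'"
  shows "coef_diag q v p p' + coef_diag q v p' p = q - inverse q"
proof (cases "confluent q p p'")
  case True
  then show ?thesis
    using assms inverse_eq_self_if_square_one[of q]
    by (auto simp: separated_def coef_diag_def confluent_commute[of q p'] divide_simps)
       (auto simp: algebra_simps confluent_def)
next
  case False
  define Q where "Q = q - inverse q"
  show ?thesis
    using assms False
    by (auto simp: separated_def coef_diag_def confluent_commute[of q p'] divide_simps simp flip: Q_def)
       (auto simp: algebra_simps)
qed

text \<open>The determinant of the same block, which is the product -1 of the two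
  eigenvalues.\<close>

lemma coef_swap_mult:
  assumes "separated q v p p'" "q \<noteq> 0"
  shows "coef_swap q v p p' * coef_swap q v p' p = 1 + coef_diag q v p p' * coef_diag q v p' p"
proof (cases "confluent q p p'")
  case True
  then have "q * q = 1" by (simp add: confluent_def power2_eq_square)
  define d where "d = (of_int (diag p') :: 'a) - of_int (diag p)"
  have d': "(of_int (diag p) :: 'a) - of_int (diag p') = - d" by (simp add: d_def)
  have "d \<noteq> 0" using assms True by (auto simp: separated_def d_def)
  have "q * (d + 1) / d * (q * (- d + 1) / - d) = (q * q) * (d * d - 1) / (d * d)"
    by (simp add: divide_simps) (simp add: algebra_simps)
  also have "\<dots> = 1 + q / d * (q / - d)"
    using \<open>q * q = 1\<close> \<open>d \<noteq> 0\<close> by (simp add: divide_simps)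
  finally have "q * (d + 1) / d * (q * (- d + 1) / - d) = 1 + q / d * (q / - d)" .
  then show ?thesis
    using True by (simp add: coef_swap_def coef_diag_def confluent_commute[of q p'] d' flip: d_def)
next
  case False
  define c c' r where "c = content q v p" and "c' = content q v p'" and "r = inverse q"
  have "q * r = 1" using assms by (simp add: r_def)
  have ne: "c' - c \<noteq> 0" "c - c' \<noteq> 0" using assms False by (auto simp: separated_def c_def c'_def)
  \<comment> \<open>With \<open>r\<close> treated as a variable, the two sides differ by a multiple
    of \<open>q * r - 1\<close>.\<close>
  have "(q * c' - r * c) * (q * c - r * c') - ((c' - c) * (c - c') + (q - r) * c' * ((q - r) * c))
      = (q * r - 1) * (2 * c * c' - c * c - c' * c')"
    by (simp add: algebra_simps)
  then have "(q * c' - r * c) * (q * c - r * c') = (c' - c) * (c - c') + (q - r) * c' * ((q - r) * c)"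
    using \<open>q * r = 1\<close> by simp
  then have "(q * c' - r * c) / (c' - c) * ((q * c - r * c') / (c - c'))
      = 1 + (q - r) * c' / (c' - c) * ((q - r) * c / (c - c'))"
    using ne by (simp add: divide_simps)
  then show ?thesis
    using False by (simp add: coef_swap_def coef_diag_def confluent_commute[of q p'] c_def c'_def r_def)
qed

text \<open>A partial fraction identity in three contents, or in three diagonals when
  \<open>q ^ 2 = 1\<close>. It matches the terms with a single exchange in the braid relation and
  also yields the Yang-Baxter equation.\<close>

lemma coef_diag_triple:
  assumes "separated q v p1 p2" "separated q v p2 p3" "separated q v p1 p3"
  shows "coef_diag q v p1 p2 * coef_diag q v p2 p3 + coef_diag q v p1 p3 * coef_diag q v p2 p1
       = coef_diag q v p2 p3 * coef_diag q v p1 p3"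
proof (cases "q ^ 2 = 1")
  case True
  note inv = inverse_eq_self_if_square_one[OF True]
  show ?thesis
  proof (cases "fst p1 = fst p2 \<and> fst p2 = fst p3")
    case True
    define x y z where "x = (of_int (diag p1) :: 'a)" and "y = (of_int (diag p2) :: 'a)"
      and "z = (of_int (diag p3) :: 'a)"
    have "y - x \<noteq> 0" "x - y \<noteq> 0" "z - x \<noteq> 0" "z - y \<noteq> 0"
      using assms True \<open>q ^ 2 = 1\<close> by (auto simp: separated_def confluent_def x_def y_def z_def)
    moreover from this have "q / (y - x) * (q / (z - y)) + q / (z - x) * (q / (x - y)) = q / (z - y) * (q / (z - x))"
      by (simp add: divide_simps) (simp add: algebra_simps)
    ultimately show ?thesis
      using True \<open>q ^ 2 = 1\<close> by (simp add: coef_diag_def confluent_def x_def y_def z_def)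
  next
    case False
    \<comment> \<open>Here \<open>q - inverse q = 0\<close>, so nodes of different diagrams have
      coefficient 0. Each product involves two different pairs of the three nodes, and at most one
      pair shares a diagram.\<close>
    with inv show ?thesis by (auto simp: coef_diag_def confluent_def)
  qed
next
  case False
  define Q x y z where "Q = q - inverse q" and "x = content q v p1" and "y = content q v p2"
    and "z = content q v p3"
  have "y - x \<noteq> 0" "x - y \<noteq> 0" "z - x \<noteq> 0" "z - y \<noteq> 0"
    using assms False by (auto simp: separated_def confluent_def x_def y_def z_def)
  then have "Q * y / (y - x) * (Q * z / (z - y)) + Q * z / (z - x) * (Q * x / (x - y))
      = Q * z / (z - y) * (Q * z / (z - x))"
    by (simp add: divide_simps) (simp add: algebra_simps)
  then show ?thesis
    using False by (simp add: coef_diag_def confluent_def x_def y_def z_def Q_def)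
qed

lemma coef_diag_triple':
  assumes "separated q v p1 p2" "separated q v p2 p3" "separated q v p1 p3"
  shows "coef_diag q v p2 p3 * coef_diag q v p1 p2 + coef_diag q v p1 p3 * coef_diag q v p3 p2
       = coef_diag q v p1 p2 * coef_diag q v p1 p3"
proof -
  \<comment> \<open>Substituting \<open>d = Q - a\<close> and \<open>f = Q - b\<close> turns
    hypothesis and conclusion into the same equation.\<close>
  have *: "b * a + c * f = a * c" if "a * b + c * d = b * c" "a + d = Q" "b + f = Q" for a b c d f Q :: 'a
  proof -
    have "d = Q - a" "f = Q - b" using that by (simp_all add: eq_diff_eq add.commute)
    show ?thesis
      using that(1) unfolding \<open>d = Q - a\<close> \<open>f = Q - b\<close> by (simp add: algebra_simps)
  qed
  show ?thesis
    by (rule *[OF coef_diag_triple[OF assms] coef_diag_add[OF assms(1)] coef_diag_add[OF assms(2)]])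
qed

text \<open>The off-diagonal obstruction to the length four relation between \<open>Tau\<close> and
  \<open>Sigma 1\<close>. In the confluent case all contents of the diagram agree and the first
  factor is 0; otherwise the second factor is 0.\<close>

lemma coef_diag_content:
  assumes "separated q v p p'"
  shows "(content q v p - content q v p') *
    (content q v p * coef_diag q v p p' + content q v p' * coef_diag q v p' p) = 0"
proof (cases "confluent q p p'")
  case True
  then have "q powi (2 * i) = 1" for i
    by (simp add: confluent_def power_int_mult)
  with True show ?thesis by (simp add: confluent_def content_def)
next
  case False
  then show ?thesis
    using assms
    by (auto simp: separated_def coef_diag_def confluent_commute[of q p'] divide_simps)
       (auto simp: algebra_simps)
qed

text \<open>For neighbours in a row or a column the diagonal coefficient is itself an eigenvalue,
  \<open>q\<close> or \<open>- inverse q\<close>. This is why dropping the term of a non-standard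
  \<open>swap i X\<close> is consistent.\<close>

lemma coef_diag_adjacent:
  assumes "separated q v p p'" "q \<noteq> 0" "v (fst p) \<noteq> 0" "fst p = fst p'"
    and d: "diag p' = diag p + 1 \<or> diag p' = diag p - 1"
  shows "1 + coef_diag q v p p' * coef_diag q v p' p = 0"
proof (cases "confluent q p p'")
  case True
  then have "q * q = 1" by (simp add: confluent_def power2_eq_square)
  with True d show ?thesis
    by (auto simp: coef_diag_def confluent_commute[of q p'])
next
  case False
  have q2: "q powi (2 * (i + 1)) = q * q * q powi (2 * i)" "q powi (2 * (i - 1)) = inverse q * inverse q * q powi (2 * i)" for i
    using assms(2) by (simp_all add: power_int_add power_int_diff algebra_simps power2_eq_square divide_simps)
  define c r where "c = content q v p" and "r = inverse q"
  have [simp]: "q * r = 1" "r * q = 1" using assms by (auto simp: r_def)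
  have "c \<noteq> 0" using assms by (simp add: c_def content_def)
  have sum: "coef_diag q v p p' + coef_diag q v p' p = q - r"
    using coef_diag_add[OF assms(1)] by (simp add: r_def)
  have ne: "content q v p' \<noteq> c" using False assms by (simp add: separated_def c_def)
  have "coef_diag q v p p' = q \<or> coef_diag q v p p' = - r"
    using d
  proof
    assume "diag p' = diag p + 1"
    then have c': "content q v p' = q * q * c"
      using assms(4) by (simp only: content_def c_def q2 mult_ac)
    have "(q - r) * (q * q * c) - q * (q * q * c - c) = (1 - q * r) * (q * c)"
      by (simp add: algebra_simps)
    then have "(q - r) * (q * q * c) = q * (q * q * c - c)" by simp
    moreover have "q * q * c - c \<noteq> 0" using ne c' by simp
    ultimately have "(q - r) * (q * q * c) / (q * q * c - c) = q"
      by (metis nonzero_divide_eq_eq)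
    moreover have "coef_diag q v p p' = (q - r) * content q v p' / (content q v p' - c)"
      using False by (simp add: coef_diag_def c_def r_def)
    ultimately show ?thesis unfolding c' by simp
  next
    assume "diag p' = diag p - 1"
    then have c': "content q v p' = r * r * c"
      using assms(4) by (simp only: content_def c_def q2 mult_ac r_def)
    have "(q - r) * (r * r * c) - - r * (r * r * c - c) = (q * r - 1) * (r * c)"
      by (simp add: algebra_simps)
    then have "(q - r) * (r * r * c) = - r * (r * r * c - c)"
      by (simp only: \<open>q * r = 1\<close> diff_self mult_zero_left right_minus_eq)
    moreover have "r * r * c - c \<noteq> 0" using ne c' by simp
    ultimately have "(q - r) * (r * r * c) / (r * r * c - c) = - r"
      by (metis nonzero_divide_eq_eq)
    moreover have "coef_diag q v p p' = (q - r) * content q v p' / (content q v p' - c)"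
      using False by (simp add: coef_diag_def c_def r_def)
    ultimately show ?thesis unfolding c' by simp
  qed
  moreover have "coef_diag q v p' p = q - r - coef_diag q v p p'"
    using sum by (simp add: algebra_simps)
  ultimately show ?thesis by auto
qed

section \<open>Combinatorics of standard tableaux\<close>

lemma nodes_down:
  assumes "is_partition (lam k)" "(k, r, s) \<in> nodes lam" "1 \<le> r'" "r' \<le> r" "1 \<le> s'" "s' \<le> s"
  shows "(k, r', s') \<in> nodes lam"
proof -
  have "lam k ! (r - 1) \<le> lam k ! (r' - 1)"
  proof (cases "r' = r")
    case False
    with assms have "r' - 1 < r - 1" "r - 1 < length (lam k)" by (auto simp: nodes_def)
    then show ?thesis
      using assms(1) by (auto simp: is_partition_def sorted_wrt_iff_nth_less)
  qed simp
  then show ?thesis using assms by (auto simp: nodes_def)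
qed

locale shape =
  fixes n :: nat and lam :: "'m \<Rightarrow> nat list"
  assumes partition: "is_partition (lam k)"
begin

abbreviation "ST \<equiv> std_tableaux n lam"
abbreviation "nd \<equiv> node_of lam"

lemma std_bij: "X \<in> ST \<Longrightarrow> bij_betw X (nodes lam) {1..n}"
  by (simp add: std_tableaux_def)

lemma std_less:
  assumes "X \<in> ST" "(k, r, s) \<in> nodes lam" "(k, r', s') \<in> nodes lam" "r \<le> r'" "s \<le> s'" "r < r' \<or> s < s'"
  shows "X (k, r, s) < X (k, r', s')"
proof -
  \<comment> \<open>The two nodes are compared through the corner in the row of the first and the
    column of the second.\<close>
  have m: "(k, r, s') \<in> nodes lam"
    by (rule nodes_down[OF partition assms(3)]) (use assms in \<open>auto simp: nodes_def\<close>)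
  have "X (k, r, s) < X (k, r, s') \<or> s = s'" "X (k, r, s') < X (k, r', s') \<or> r = r'"
    using assms m by (force simp: std_tableaux_def)+
  then show ?thesis using assms(6) by auto
qed

lemma node_of_in: "X \<in> ST \<Longrightarrow> i \<in> {1..n} \<Longrightarrow> nd X i \<in> nodes lam"
  and entry_node_of: "X \<in> ST \<Longrightarrow> i \<in> {1..n} \<Longrightarrow> X (nd X i) = i"
  using std_bij[of X] by (auto simp: node_of_def bij_betw_def inv_into_into f_inv_into_f)

lemma node_of_entry: "X \<in> ST \<Longrightarrow> p \<in> nodes lam \<Longrightarrow> nd X (X p) = p"
  using std_bij[of X] by (auto simp: node_of_def bij_betw_def)

lemma entry_range: "X \<in> ST \<Longrightarrow> p \<in> nodes lam \<Longrightarrow> X p \<in> {1..n}"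
  using std_bij[of X] by (auto simp: bij_betw_def)

lemma node_of_eqI: "X \<in> ST \<Longrightarrow> p \<in> nodes lam \<Longrightarrow> X p = i \<Longrightarrow> nd X i = p"
  using node_of_entry by metis

lemma swap_swap [simp]: "swap i (swap i X) = X"
  by (simp add: swap_def fun_eq_iff)

lemma bij_swap:
  assumes "bij_betw X (nodes lam) {1..n}" "1 \<le> i" "i < n"
  shows "bij_betw (swap i X) (nodes lam) {1..n}"
  unfolding swap_def using assms
  by (intro bij_betw_trans[OF assms(1)]
        bij_betw_byWitness[where f' = "Transposition.transpose i (i + 1)"])
     (auto simp: Transposition.transpose_def)

lemma node_of_swap:
  assumes bij: "bij_betw X (nodes lam) {1..n}" and i: "1 \<le> i" "i < n" "j \<in> {1..n}"
  shows "nd (swap i X) j = nd X (Transposition.transpose i (i + 1) j)"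
proof -
  let ?j = "Transposition.transpose i (i + 1) j"
  have j: "?j \<in> {1..n}"
    using i by (auto simp: Transposition.transpose_def)
  have "nd X ?j \<in> nodes lam" "swap i X (nd X ?j) = j"
    using bij j by (auto simp: node_of_def bij_betw_def swap_def inv_into_into f_inv_into_f)
  then show ?thesis
    unfolding node_of_def[of lam "swap i X"]
    using bij_swap[OF bij i(1,2)] by (intro inv_into_f_eq) (auto simp: bij_betw_def)
qed

text \<open>The exchange reverses the order of the entries \<open>i\<close> and \<open>i + 1\<close>
  only, so a violation puts these two in one row or column. No entry fits strictly between them,
  hence their nodes are adjacent.\<close>

lemma swap_not_std:
  assumes X: "X \<in> ST" and i: "1 \<le> i" "i < n" and n: "swap i X \<notin> ST"
  obtains k r s where "nd X i = (k, r, s)" "nd X (i + 1) = (k, r, s + 1) \<or> nd X (i + 1) = (k, r + 1, s)"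
proof -
  have bij: "bij_betw (swap i X) (nodes lam) {1..n}"
    by (rule bij_swap[OF std_bij[OF X] i])
  have zero: "swap i X p = 0" if "p \<notin> nodes lam" for p
  proof -
    have "\<forall>p. p \<notin> nodes lam \<longrightarrow> X p = 0"
      using X unfolding std_tableaux_def mem_Collect_eq by (elim conjE)
    then have "X p = 0" using that by blast
    then show ?thesis using i by (simp add: swap_def Transposition.transpose_def)
  qed
  have rev: "X p = i \<and> X p' = i + 1" if "X p < X p'" "\<not> swap i X p < swap i X p'" for p p'
    using that by (auto simp: swap_def Transposition.transpose_def split: if_splits)
  have "\<not> ((\<forall>k r s s'. (k, r, s) \<in> nodes lam \<and> (k, r, s') \<in> nodes lam \<and> s < s'
              \<longrightarrow> swap i X (k, r, s) < swap i X (k, r, s')) \<and>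
         (\<forall>k r r' s. (k, r, s) \<in> nodes lam \<and> (k, r', s) \<in> nodes lam \<and> r < r'
            \<longrightarrow> swap i X (k, r, s) < swap i X (k, r', s)))"
    using n bij zero unfolding std_tableaux_def mem_Collect_eq by metis
  then consider
      (row) k r s s' where "(k, r, s) \<in> nodes lam" "(k, r, s') \<in> nodes lam" "s < s'"
        "\<not> swap i X (k, r, s) < swap i X (k, r, s')"
    | (col) k r r' s where "(k, r, s) \<in> nodes lam" "(k, r', s) \<in> nodes lam" "r < r'"
        "\<not> swap i X (k, r, s) < swap i X (k, r', s)"
    by blast
  then show ?thesis
  proof cases
    case row
    then have e: "X (k, r, s) = i" "X (k, r, s') = i + 1"
      using rev[of "(k, r, s)" "(k, r, s')"] std_less[OF X, of k r s r s'] by auto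
    have "s' = s + 1"
    proof (rule ccontr)
      assume "s' \<noteq> s + 1"
      moreover have "(k, r, s + 1) \<in> nodes lam" using row by (auto simp: nodes_def)
      ultimately have "X (k, r, s) < X (k, r, s + 1)" "X (k, r, s + 1) < X (k, r, s')"
        using row by (auto intro!: std_less[OF X])
      then show False using e by simp
    qed
    then have 1: "nd X i = (k, r, s)" and 2: "nd X (i + 1) = (k, r, s + 1)"
      using node_of_eqI[OF X row(1)] node_of_eqI[OF X row(2)] e by simp_all
    show ?thesis by (rule that[OF 1 disjI1[OF 2]])
  next
    case col
    then have e: "X (k, r, s) = i" "X (k, r', s) = i + 1"
      using rev[of "(k, r, s)" "(k, r', s)"] std_less[OF X, of k r s r' s] by auto
    have "r' = r + 1"
    proof (rule ccontr)
      assume "r' \<noteq> r + 1"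
      moreover have "(k, r + 1, s) \<in> nodes lam"
        by (rule nodes_down[OF partition col(2)]) (use col in \<open>auto simp: nodes_def\<close>)
      ultimately have "X (k, r, s) < X (k, r + 1, s)" "X (k, r + 1, s) < X (k, r', s)"
        using col by (auto intro!: std_less[OF X])
      then show False using e by simp
    qed
    then have 1: "nd X i = (k, r, s)" and 2: "nd X (i + 1) = (k, r + 1, s)"
      using node_of_eqI[OF X col(1)] node_of_eqI[OF X col(2)] e by simp_all
    show ?thesis by (rule that[OF 1 disjI2[OF 2]])
  qed
qed

text \<open>A non-standard exchange would involve neighbours, which have the same order in every
  standard tableau, while \<open>Z\<close> has them in the opposite order. Standardness along a path
  is thus deduced from its far end.\<close>

lemma swap_std:
  assumes X: "X \<in> ST" and i: "1 \<le> i" "i < n" and Z: "Z \<in> ST" and less: "Z (nd X (i + 1)) < Z (nd X i)"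
  shows "swap i X \<in> ST"
proof (rule ccontr)
  assume "swap i X \<notin> ST"
  then obtain k r s where "nd X i = (k, r, s)" "nd X (i + 1) = (k, r, s + 1) \<or> nd X (i + 1) = (k, r + 1, s)"
    using swap_not_std[OF X i] by metis
  moreover have "nd X i \<in> nodes lam" "nd X (i + 1) \<in> nodes lam"
    using X i by (auto intro!: node_of_in)
  ultimately have "Z (nd X i) < Z (nd X (i + 1))"
    by (auto intro!: std_less[OF Z])
  with less show False by simp
qed

text \<open>The right and the lower neighbour of the smaller node carry two distinct entries
  strictly between \<open>X p\<close> and \<open>X p'\<close>. The bound 3 just exceeds the distance
  2 occurring in a braid relation.\<close>

lemma diag_distance:
  assumes X: "X \<in> ST" and p: "p \<in> nodes lam" "p' \<in> nodes lam" "fst p = fst p'" "diag p = diag p'" "X p < X p'"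
  shows "X p + 3 \<le> X p'"
proof -
  obtain k r s where p1: "p = (k, r, s)" by (cases p)
  obtain r' s' where p2: "p' = (k, r', s')" using p p1 by (cases p') auto
  have "r < r'" "s < s'"
  proof -
    have "int s - int r = int s' - int r'" using p p1 p2 by simp
    moreover have "\<not> (r' \<le> r \<and> s' \<le> s)"
      using std_less[OF X, of k r' s' r s] p p1 p2 by (cases "r' = r \<and> s' = s") auto
    ultimately show "r < r'" "s < s'" by linarith+
  qed
  moreover have m: "(k, r + 1, s) \<in> nodes lam" "(k, r, s + 1) \<in> nodes lam"
  proof -
    have n: "(k, r', s') \<in> nodes lam" and "1 \<le> r" "1 \<le> s"
      using p p1 p2 by (simp_all add: nodes_def)
    then show "(k, r + 1, s) \<in> nodes lam" "(k, r, s + 1) \<in> nodes lam"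
      using calculation by (auto intro!: nodes_down[where r=r' and s=s' and lam=lam and k=k, OF partition[of k] n])
  qed
  ultimately have "X p < X (k, r + 1, s)" "X (k, r + 1, s) < X p'" "X p < X (k, r, s + 1)" "X (k, r, s + 1) < X p'"
    using p p1 p2 by (auto intro!: std_less[OF X])
  moreover have "X (k, r + 1, s) \<noteq> X (k, r, s + 1)"
    using m std_bij[OF X] by (auto simp: bij_betw_def dest: inj_onD)
  ultimately show ?thesis by linarith
qed

lemma finite_nodes: "X \<in> ST \<Longrightarrow> finite (nodes lam)"
  using std_bij bij_betw_finite by blast

text \<open>The \<open>s\<close> nodes of the row up to \<open>p\<close> and the \<open>r'\<close>
  nodes of the column down to \<open>p'\<close> share at most one node, and none if the diagrams
  differ. The 1 gained in that case absorbs the shift by \<open>q ^ 2\<close> in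
  \<open>coef_swap_nonzero\<close>, where exponents must stay strictly below
  \<open>n\<close>.\<close>

lemma diag_diff_bound:
  assumes X: "X \<in> ST" and p: "p \<in> nodes lam" "p' \<in> nodes lam"
  shows "diag p - diag p' + (if fst p = fst p' then 0 else 1) < int n"
proof -
  obtain k r s where p1: "p = (k, r, s)" by (cases p)
  obtain k' r' s' where p2: "p' = (k', r', s')" by (cases p')
  let ?R = "(\<lambda>j. (k, r, j)) ` {1..s}" and ?C = "(\<lambda>j. (k', j, s')) ` {1..r'}"
  have pos: "1 \<le> r" "1 \<le> s'" using p p1 p2 by (auto simp: nodes_def)
  have sub: "?R \<union> ?C \<subseteq> nodes lam"
  proof (intro Un_least subsetI)
    fix x assume "x \<in> ?R"
    then show "x \<in> nodes lam" using p p1 by (auto simp: nodes_def)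
  next
    fix x assume "x \<in> ?C"
    then obtain j where "x = (k', j, s')" "1 \<le> j" "j \<le> r'" by auto
    then show "x \<in> nodes lam"
      using nodes_down[of lam k' r' s' j s'] partition p p2 pos by simp
  qed
  have "card (nodes lam) = n"
    using bij_betw_same_card[OF std_bij[OF X]] by simp
  then have "card (?R \<union> ?C) \<le> n"
    using card_mono[OF finite_nodes[OF X] sub] by simp
  moreover have "card ?R = s" "card ?C = r'"
    by (auto simp: card_image inj_on_def)
  moreover have "card (?R \<inter> ?C) \<le> (if k = k' then 1 else 0)"
  proof (cases "k = k'")
    case True
    have "card (?R \<inter> ?C) \<le> card {(k, r, s')}"
      using True by (intro card_mono) auto
    with True show ?thesis by simp
  qed auto
  moreover have "card ?R + card ?C = card (?R \<union> ?C) + card (?R \<inter> ?C)"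
    by (intro card_Un_Int) auto
  ultimately have "s + r' \<le> n + (if k = k' then 1 else 0)" by simp
  then show ?thesis
    using pos p1 p2 by (auto split: if_splits)
qed

lemma finite_std: "finite ST"
proof (cases "ST = {}")
  case False
  then have "finite (nodes lam)" using finite_nodes by auto
  then have "finite {f. \<forall>p. (p \<in> nodes lam \<longrightarrow> f p \<in> {1..n}) \<and> (p \<notin> nodes lam \<longrightarrow> f p = 0)}"
    by (intro finite_set_of_finite_funs) auto
  then show ?thesis
    by (rule rev_finite_subset) (use entry_range in \<open>auto simp: std_tableaux_def bij_betw_def\<close>)
qed simp

end

section \<open>The seminormal representation\<close>

lemma sum_fun_apply: "(\<Sum>x\<in>A. F x) y = (\<Sum>x\<in>A. F x y)"
  by (induction A rule: infinite_finite_induct) auto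

section \<open>Consequences of the parameter conditions\<close>

lemma admissible_sum:
  assumes "admissible n q v" "1 \<le> m" "m \<le> n"
  shows "(\<Sum>i<m. (q ^ 2) ^ i) \<noteq> 0"
proof -
  have "{..m - 1} = {..<m}" using assms by auto
  moreover have "(\<Sum>i\<le>m - 1. q ^ (2 * i)) \<noteq> 0"
    using assms by (auto simp: admissible_def)
  ultimately show ?thesis by (simp add: power_mult)
qed

text \<open>For \<open>q ^ 2 = 1\<close> the sums in \<open>admissible\<close> are the integers from
  1 to \<open>n\<close>, so these are nonzero in the field.\<close>

lemma admissible_of_int:
  fixes q :: "'k::field"
  assumes "admissible n q v" "q ^ 2 = 1" "of_int m = (0::'k)" "\<bar>m\<bar> \<le> int n"
  shows "m = 0"
proof (rule ccontr)
  assume "m \<noteq> 0"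
  then have "(of_nat (nat \<bar>m\<bar>) :: 'k) \<noteq> 0"
    using admissible_sum[OF assms(1), of "nat \<bar>m\<bar>"] assms(2,4) by auto
  then show False using assms(3) by (cases "m \<ge> 0") auto
qed

text \<open>A geometric sum: \<open>q ^ 2 - 1\<close> times one of the nonzero sums in
  \<open>admissible\<close> is a power of \<open>q ^ 2\<close> minus 1.\<close>

lemma admissible_power_int:
  fixes q :: "'k::field"
  assumes "admissible n q v" "q ^ 2 \<noteq> 1" "q powi (2 * m) = 1" "\<bar>m\<bar> \<le> int n"
  shows "m = 0"
proof (rule ccontr)
  assume m: "m \<noteq> 0"
  have "(q ^ 2) ^ nat \<bar>m\<bar> - 1 = (q ^ 2 - 1) * (\<Sum>i<nat \<bar>m\<bar>. (q ^ 2) ^ i)"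
    by (rule power_diff_1_eq)
  moreover have "(\<Sum>i<nat \<bar>m\<bar>. (q ^ 2) ^ i) \<noteq> 0"
    using m assms(4) by (intro admissible_sum[OF assms(1)]) auto
  ultimately have "(q ^ 2) ^ nat \<bar>m\<bar> \<noteq> 1"
    using assms(2) by auto
  moreover have "(q ^ 2) ^ nat \<bar>m\<bar> = 1"
  proof (cases "m \<ge> 0")
    case False
    then have "nat (- (2 * m)) = 2 * nat (- m)" by linarith
    with False assms(3) show ?thesis
      by (simp add: power_int_def power_mult power_inverse)
  qed (use assms(3) in \<open>simp add: power_int_def power_mult nat_mult_distrib\<close>)
  ultimately show False by simp
qed

locale seminormal = shape n lam
  for n :: nat and lam :: "'m::{finite,linorder} \<Rightarrow> nat list" +
  fixes q :: "'k::field" and v :: "'m \<Rightarrow> 'k"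
  assumes admissible: "admissible n q v"
begin

abbreviation "cd \<equiv> coef_diag q v"
abbreviation "cs \<equiv> coef_swap q v"
abbreviation "ct \<equiv> content q v"

lemma q_nonzero: "q \<noteq> 0" and v_nonzero: "v k \<noteq> 0"
  using admissible by (auto simp: admissible_def)

lemma content_eq_iff:
  "ct p = q powi (2 * i) * ct p' \<longleftrightarrow> v (fst p) * q powi (2 * (diag p - diag p' - i)) = v (fst p')"
proof -
  have "q powi (2 * diag p) = q powi (2 * (diag p - diag p' - i)) * (q powi (2 * i) * q powi (2 * diag p'))"
    using q_nonzero by (simp add: algebra_simps flip: power_int_add)
  then show ?thesis using q_nonzero by (auto simp: content_def mult_ac)
qed

text \<open>The case \<open>i = 0\<close> separates contents, and \<open>i = 1\<close> controls the
  zeros of the numerator of \<open>coef_swap\<close>.\<close>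

lemma content_shift_eq:
  assumes "ct p = q powi (2 * i) * ct p'" "\<bar>diag p - diag p' - i\<bar> \<le> int n"
    and "fst p \<noteq> fst p' \<Longrightarrow> \<bar>diag p - diag p' - i\<bar> < int n"
    and "\<not> confluent q p p'"
  shows "fst p = fst p' \<and> diag p - diag p' = i"
proof -
  let ?d = "diag p - diag p' - i"
  have eq: "q powi (2 * ?d) * v (fst p) = v (fst p')"
    using assms(1) content_eq_iff by (simp add: mult.commute)
  have fst: "fst p = fst p'"
  proof (rule ccontr)
    assume ne: "fst p \<noteq> fst p'"
    then have "- int n < ?d \<and> ?d < int n" using assms(3) by auto
    moreover have "\<forall>(i::int) j k. j \<noteq> k \<and> - int n < i \<and> i < int n \<longrightarrow> q powi (2 * i) * v j - v k \<noteq> 0"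
      using admissible unfolding admissible_def by blast
    ultimately have "q powi (2 * ?d) * v (fst p) - v (fst p') \<noteq> 0"
      using ne by blast
    with eq show False by simp
  qed
  moreover from this have "q powi (2 * ?d) = 1" using eq v_nonzero by simp
  ultimately have "?d = 0"
    using assms(2,4) by (intro admissible_power_int[OF admissible]) (auto simp: confluent_def)
  with fst show ?thesis by simp
qed

lemma separated_nodes:
  assumes X: "X \<in> ST" and p: "p \<in> nodes lam" "p' \<in> nodes lam" and d: "fst p = fst p' \<Longrightarrow> diag p \<noteq> diag p'"
  shows "separated q v p p'"
proof -
  have b: "\<bar>diag p - diag p'\<bar> < int n"
    using diag_diff_bound[OF X p] diag_diff_bound[OF X p(2,1)] by (auto split: if_splits)
  show ?thesis
  proof (cases "confluent q p p'")
    case True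
    then have "(of_int (diag p - diag p') :: 'k) \<noteq> 0"
      using admissible_of_int[OF admissible, of "diag p - diag p'"] d b by (auto simp: confluent_def)
    with True show ?thesis by (simp add: separated_def)
  next
    case False
    then show ?thesis
      using content_shift_eq[of p 0 p'] d b by (auto simp: separated_def)
  qed
qed

lemma separated_near:
  assumes X: "X \<in> ST" and i: "i \<in> {1..n}" "j \<in> {1..n}" "i \<noteq> j" "i \<le> j + 2" "j \<le> i + 2"
  shows "separated q v (nd X i) (nd X j)"
proof (rule separated_nodes[OF X])
  assume "fst (nd X i) = fst (nd X j)"
  then show "diag (nd X i) \<noteq> diag (nd X j)"
    using diag_distance[OF X, of "nd X i" "nd X j"] diag_distance[OF X, of "nd X j" "nd X i"] i
    by (cases i j rule: linorder_cases) (auto simp: node_of_in[OF X] entry_node_of[OF X])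
qed (use X i in \<open>auto intro: node_of_in\<close>)

text \<open>A vanishing numerator puts both nodes into one diagram with diagonals differing by 1.
  One of them then lies weakly above and weakly to the left of the other, so their order is forced,
  and \<open>X\<close> and \<open>swap i X\<close> cannot both be standard.\<close>

lemma coef_swap_nonzero:
  assumes X: "X \<in> ST" and i: "1 \<le> i" "i < n" and Y: "swap i X \<in> ST"
  shows "cs (nd X i) (nd X (i + 1)) \<noteq> 0"
proof
  assume z: "cs (nd X i) (nd X (i + 1)) = 0"
  define p p' where "p = nd X i" and "p' = nd X (i + 1)"
  have p: "p \<in> nodes lam" "p' \<in> nodes lam" "X p = i" "X p' = i + 1"
    using X i by (auto simp: p_def p'_def node_of_in entry_node_of)
  have sep: "separated q v p p'"
    unfolding p_def p'_def using i by (intro separated_near[OF X]) auto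
  have b: "\<bar>diag p - diag p' - 1\<bar> \<le> int n" "fst p \<noteq> fst p' \<Longrightarrow> \<bar>diag p - diag p' - 1\<bar> < int n"
    using diag_diff_bound[OF X p(1,2)] diag_diff_bound[OF X p(2,1)] by (auto split: if_splits)
  have d: "fst p = fst p' \<and> diag p - diag p' = 1"
  proof (cases "confluent q p p'")
    case True
    then have "(of_int (diag p' - diag p) :: 'k) \<noteq> 0" using sep by (simp add: separated_def)
    then have "(of_int (diag p' - diag p + 1) :: 'k) = 0"
      using True z q_nonzero unfolding coef_swap_def p_def p'_def
      by (simp del: of_int_diff of_int_add)
    then have "diag p' - diag p + 1 = 0"
      using b True by (intro admissible_of_int[OF admissible]) (auto simp: confluent_def)
    with True show ?thesis by (simp add: confluent_def)
  next
    case False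
    then have "q * ct p' = inverse q * ct p"
      using z sep by (auto simp: coef_swap_def separated_def p_def p'_def)
    then have "ct p = q powi (2 * 1) * ct p'"
      using q_nonzero by (simp add: field_simps power2_eq_square)
    then show ?thesis using content_shift_eq b False by blast
  qed
  obtain k r s where p1: "p = (k, r, s)" by (cases p)
  obtain r' s' where p2: "p' = (k, r', s')" using p1 d by (cases p') auto
  have Y': "swap i X p' < swap i X p" using p by (simp add: swap_def)
  show False
  proof (cases "r' \<le> r")
    case True
    then have "s' < s" using d p1 p2 by auto
    then show False using std_less[OF X, of k r' s' r s] True p p1 p2 by auto
  next
    case False
    then have "r < r'" "s \<le> s'" using d p1 p2 by auto
    then show False using std_less[OF Y, of k r s r' s'] p p1 p2 Y' by auto
  qed
qed

section \<open>Matrix coefficients of the generators\<close>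

definition alpha :: "'m filling \<Rightarrow> nat \<Rightarrow> 'k" where
  "alpha X i = cd (nd X i) (nd X (i + 1))"

text \<open>The coefficient \<open>beta X i\<close> belongs to the arrow from \<open>swap i X\<close> to \<open>X\<close>. Since it vanishes unless both
  are standard, \<open>V_Sigma\<close> below holds at every filling and the defining relations become
  identities between coefficients, without cases on which tableaux of an orbit are standard.\<close>

definition beta :: "'m filling \<Rightarrow> nat \<Rightarrow> 'k" where
  "beta X i = (if X \<in> ST \<and> swap i X \<in> ST then cs (nd X (i + 1)) (nd X i) else 0)"

lemma std_vec_apply: "(std_vec n lam X :: _ \<Rightarrow> 'k) Y = (if X \<in> ST \<and> Y = X then 1 else 0)"
  by (auto simp: std_vec_def bvec_def)

lemma V_op_Tau: "V_op n q v lam Tau f X = (if X \<in> ST then ct (nd X 1) * f X else 0)"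
proof -
  have "V_op n q v lam Tau f X = (\<Sum>Y\<in>ST. if Y = X then ct (nd X 1) * f X else 0)"
    by (auto simp: sum_fun_apply fscale_def bvec_def intro!: sum.cong)
  then show ?thesis by (simp add: finite_std)
qed

text \<open>The sum over sources is read at its target: \<open>X\<close> is reached only from
  \<open>X\<close> and from \<open>swap i X\<close>, so the swap coefficient appears with the two
  nodes reversed.\<close>

lemma V_op_Sigma:
  assumes i: "1 \<le> i" "i < n"
  shows "V_op n q v lam (Sigma i) f X = (if X \<in> ST then alpha X i * f X + beta X i * f (swap i X) else 0)"
proof -
  have nd: "nd (swap i Y) i = nd Y (i + 1)" "nd (swap i Y) (i + 1) = nd Y i" if "Y \<in> ST" for Y
    using node_of_swap[OF std_bij[OF that] i] i by auto
  have "V_op n q v lam (Sigma i) f X = (\<Sum>Y\<in>ST. (if Y = X then alpha X i * f X else 0)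
      + (if Y = swap i X then beta X i * f (swap i X) else 0))"
    unfolding V_op.simps sum_fun_apply
  proof (intro sum.cong refl)
    fix Y assume Y: "Y \<in> ST"
    have "cs (nd Y i) (nd Y (i + 1)) * std_vec n lam (swap i Y) X = (if Y = swap i X then beta X i else 0)"
      using Y nd[of X] by (auto simp: std_vec_apply beta_def)
    then show "fscale (f Y) (let p = nd Y i; p' = nd Y (i + 1)
        in fscale (cd p p') (bvec Y) + fscale (cs p p') (std_vec n lam (swap i Y))) X
      = (if Y = X then alpha X i * f X else 0) + (if Y = swap i X then beta X i * f (swap i X) else 0)"
      by (auto simp: fscale_def bvec_def alpha_def Let_def distrib_left split: if_splits)
  qed
  then show ?thesis by (auto simp: sum.distrib finite_std beta_def)
qed

abbreviation "V \<equiv> V_op n q v lam"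
abbreviation "bijective X \<equiv> bij_betw X (nodes lam) {1..n}"

lemma linear_ops_V: "linear_ops V"
proof
  fix g f f' c
  show "V g (f + f') = V g f + V g f'"
    by (cases g) (auto simp: fun_eq_iff sum_fun_apply fscale_def Let_def algebra_simps sum.distrib)
  show "V g (fscale c f) = fscale c (V g f)"
    by (cases g) (auto simp: fun_eq_iff sum_fun_apply fscale_def Let_def algebra_simps sum_distrib_left)
qed

lemma V_supported: "g \<in> hgens n \<Longrightarrow> V g f \<in> supported ST"
  unfolding hgens_def supported_def by (auto simp: V_op_Tau V_op_Sigma simp del: V_op.simps)

lemma V_Sigma:
  assumes "1 \<le> i" "i < n" "f \<in> supported ST"
  shows "V (Sigma i) f X = alpha X i * f X + beta X i * f (swap i X)"
  using assms by (auto simp: V_op_Sigma supported_def beta_def simp del: V_op.simps)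

lemma V_Tau:
  assumes "f \<in> supported ST"
  shows "V Tau f X = ct (nd X 1) * f X"
  using assms by (auto simp: V_op_Tau supported_def simp del: V_op.simps)

lemma node_of_swap_simps:
  assumes "bijective X" "1 \<le> i" "i < n"
  shows "nd (swap i X) i = nd X (Suc i)" "nd (swap i X) (Suc i) = nd X i"
    and "j \<in> {1..n} \<Longrightarrow> j \<noteq> i \<Longrightarrow> j \<noteq> Suc i \<Longrightarrow> nd (swap i X) j = nd X j"
  using assms by (auto simp: node_of_swap)

text \<open>The determinant identity for all standard \<open>X\<close>: if \<open>swap i X\<close>
  is not standard, then \<open>i\<close> and \<open>i + 1\<close> occupy neighbours and both sides
  are 0.\<close>

lemma beta_mult:
  assumes X: "X \<in> ST" and i: "1 \<le> i" "i < n"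
  shows "beta X i * beta (swap i X) i = 1 + cd (nd X i) (nd X (i + 1)) * cd (nd X (i + 1)) (nd X i)"
proof -
  have sep: "separated q v (nd X i) (nd X (i + 1))"
    using i by (intro separated_near[OF X]) auto
  show ?thesis
  proof (cases "swap i X \<in> ST")
    case True
    then show ?thesis
      using X i coef_swap_mult[OF sep q_nonzero]
      by (simp add: beta_def node_of_swap_simps[OF std_bij[OF X] i] mult.commute)
  next
    case False
    then obtain k r s where "nd X i = (k, r, s)" "nd X (i + 1) = (k, r, s + 1) \<or> nd X (i + 1) = (k, r + 1, s)"
      using swap_not_std[OF X i] by metis
    then have "1 + cd (nd X i) (nd X (i + 1)) * cd (nd X (i + 1)) (nd X i) = 0"
      using sep q_nonzero v_nonzero by (intro coef_diag_adjacent) auto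
    with False show ?thesis by (simp add: beta_def)
  qed
qed

section \<open>The defining relations on the seminormal space\<close>

lemma V_quadratic:
  assumes i: "1 \<le> i" "i < n" and f: "f \<in> supported ST"
  shows "V (Sigma i) (V (Sigma i) f) = fscale (q - inverse q) (V (Sigma i) f) + f"
proof
  fix X
  have g: "Sigma i \<in> hgens n" using i by (auto simp: hgens_def)
  show "V (Sigma i) (V (Sigma i) f) X = (fscale (q - inverse q) (V (Sigma i) f) + f) X"
  proof (cases "X \<in> ST")
    case True
    define a a' where "a = cd (nd X i) (nd X (i + 1))" and "a' = cd (nd X (i + 1)) (nd X i)"
    have s: "a + a' = q - inverse q"
      unfolding a_def a'_def using i by (intro coef_diag_add separated_near[OF True]) auto
    have al: "alpha X i = a" "alpha (swap i X) i = a'"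
      by (simp_all add: alpha_def a_def a'_def node_of_swap_simps[OF std_bij[OF True] i])
    have "V (Sigma i) (V (Sigma i) f) X =
        a * (a * f X + beta X i * f (swap i X)) + beta X i * (a' * f (swap i X) + beta (swap i X) i * f X)"
      by (simp add: V_Sigma[OF i] f V_supported[OF g] al del: V_op.simps)
    also have "\<dots> = a * a * f X + (beta X i * beta (swap i X) i) * f X + (a + a') * beta X i * f (swap i X)"
      by (simp add: algebra_simps)
    \<comment> \<open>By \<open>beta_mult\<close> the coefficient of \<open>f X\<close> is
      \<open>a * a + 1 + a * a'\<close>, which equals \<open>(a + a') * a + 1\<close>.\<close>
    also have "\<dots> = (a + a') * (a * f X + beta X i * f (swap i X)) + f X"
      unfolding beta_mult[OF True i] a_def[symmetric] a'_def[symmetric] by (simp add: algebra_simps)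
    finally show ?thesis
      by (simp add: s fscale_def V_Sigma[OF i f] al del: V_op.simps)
  next
    case False
    then show ?thesis using f by (simp add: V_op_Sigma[OF i] fscale_def supported_def del: V_op.simps)
  qed
qed

text \<open>Both sides of the braid relation evaluated at a tableau with nodes 1, 2, 3 in three consecutive
  positions; \<open>f12\<close> etc. are the values at the permuted fillings, \<open>a\<close> are diagonal coefficients and
  \<open>B\<close>, \<open>C\<close>, \<open>D\<close> swap coefficients.\<close>

lemma braid_coefficients:
  fixes f f1 f2 f12 f21 f121 :: 'k
  assumes "a12 * a23 + a13 * a21 = a23 * a13" "a23 * a12 + a13 * a32 = a12 * a13"
    and "B1 * B1' = 1 + a12 * a21" "B2 * B2' = 1 + a23 * a32" "B1 * C1 * D1 = B2 * C2 * D2"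
  shows "a12 * (a23 * (a12 * f + B1 * f1) + B2 * (a13 * f2 + C2 * f21))
       + B1 * (a13 * (a21 * f1 + B1' * f) + C1 * (a23 * f12 + D1 * f121))
       = a23 * (a12 * (a23 * f + B2 * f2) + B1 * (a13 * f1 + C1 * f12))
       + B2 * (a13 * (a32 * f2 + B2' * f) + C2 * (a12 * f21 + D2 * f121))" (is "?L = ?R")
proof -
  \<comment> \<open>The terms in \<open>f12\<close> and \<open>f21\<close> cancel identically; the
    remaining ones are grouped by the hypothesis that makes them vanish.\<close>
  have "?L - ?R = f * (a12 * (a12 * a23 + a13 * a21 - a23 * a13) - a23 * (a23 * a12 + a13 * a32 - a12 * a13)
        + a13 * (B1 * B1' - (1 + a12 * a21)) - a13 * (B2 * B2' - (1 + a23 * a32)))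
      + B1 * f1 * (a12 * a23 + a13 * a21 - a23 * a13)
      - B2 * f2 * (a23 * a12 + a13 * a32 - a12 * a13) + f121 * (B1 * C1 * D1 - B2 * C2 * D2)"
    by (simp add: algebra_simps)
  also have "\<dots> = 0" by (simp only: assms) simp
  finally show ?thesis by simp
qed

lemma swap_braid: "swap i (swap (Suc i) (swap i X)) = swap (Suc i) (swap i (swap (Suc i) X))"
  by (auto simp: swap_def fun_eq_iff Transposition.transpose_def)

lemma V_braid:
  assumes i: "1 \<le> i" "i + 1 < n" and f: "f \<in> supported ST"
  shows "V (Sigma i) (V (Sigma (i + 1)) (V (Sigma i) f)) = V (Sigma (i + 1)) (V (Sigma i) (V (Sigma (i + 1)) f))"
proof
  fix X
  have j: "1 \<le> i" "i < n" "1 \<le> Suc i" "Suc i < n" using i by auto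
  have g: "Sigma i \<in> hgens n" "Sigma (Suc i) \<in> hgens n" using i by (auto simp: hgens_def)
  show "V (Sigma i) (V (Sigma (i + 1)) (V (Sigma i) f)) X = V (Sigma (i + 1)) (V (Sigma i) (V (Sigma (i + 1)) f)) X"
  proof (cases "X \<in> ST")
    case X: True
    define p1 p2 p3 where "p1 = nd X i" and "p2 = nd X (Suc i)" and "p3 = nd X (Suc (Suc i))"
    have sep: "separated q v p1 p2" "separated q v p2 p3" "separated q v p1 p3"
      unfolding p1_def p2_def p3_def using i by (auto intro!: separated_near[OF X])
    let ?X1 = "swap i X" and ?X2 = "swap (Suc i) X"
    let ?X12 = "swap (Suc i) ?X1" and ?X21 = "swap i ?X2"
    let ?X121 = "swap i ?X12"
    note bij = std_bij[OF X]
    note bij1 = bij_swap[OF bij j(1,2)] and bij2 = bij_swap[OF bij j(3,4)]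
    note bij12 = bij_swap[OF bij1 j(3,4)] and bij21 = bij_swap[OF bij2 j(1,2)]
    note nds = node_of_swap_simps[OF bij j(1,2)] node_of_swap_simps[OF bij j(3,4)]
      node_of_swap_simps[OF bij1 j(3,4)] node_of_swap_simps[OF bij2 j(1,2)]
      node_of_swap_simps[OF bij12 j(1,2)] node_of_swap_simps[OF bij21 j(3,4)]
    have [simp]: "nd X i = p1" "nd X (Suc i) = p2" "nd X (Suc (Suc i)) = p3"
      by (auto simp: p1_def p2_def p3_def)
    have 1 [simp]: "nd ?X1 i = p2" "nd ?X1 (Suc i) = p1" "nd ?X1 (Suc (Suc i)) = p3"
      using i by (auto simp: nds)
    have 2 [simp]: "nd ?X2 i = p1" "nd ?X2 (Suc i) = p3" "nd ?X2 (Suc (Suc i)) = p2"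
      using i by (auto simp: nds)
    have 12 [simp]: "nd ?X12 i = p2" "nd ?X12 (Suc i) = p3" "nd ?X12 (Suc (Suc i)) = p1"
      using i by (auto simp: nds)
    have 21 [simp]: "nd ?X21 i = p3" "nd ?X21 (Suc i) = p1" "nd ?X21 (Suc (Suc i)) = p2"
      using i by (auto simp: nds)
    \<comment> \<open>\<open>?X121\<close> has the three nodes in reverse order, so it is a witness
      for \<open>swap_std\<close> at each exchange on both paths leading to it.\<close>
    have all_std: "?X1 \<in> ST" "?X2 \<in> ST" "?X12 \<in> ST" "?X21 \<in> ST" if Z: "?X121 \<in> ST"
    proof -
      have e: "X p1 = i" "X p2 = Suc i" "X p3 = Suc (Suc i)"
        using i entry_node_of[OF X, of i] entry_node_of[OF X, of "Suc i"] entry_node_of[OF X, of "Suc (Suc i)"] by auto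
      then have z: "?X121 p3 = i" "?X121 p2 = Suc i" "?X121 p1 = Suc (Suc i)"
        by (auto simp: swap_def Transposition.transpose_def)
      show 1: "?X1 \<in> ST" by (rule swap_std[OF X j(1,2) Z]) (simp add: z)
      show 2: "?X2 \<in> ST" by (rule swap_std[OF X j(3,4) Z]) (simp add: z)
      show "?X12 \<in> ST" by (rule swap_std[OF 1 j(3,4) Z]) (simp add: z)
      show "?X21 \<in> ST" by (rule swap_std[OF 2 j(1,2) Z]) (simp add: z)
    qed
    have B1: "beta X i * beta ?X1 i = 1 + cd p1 p2 * cd p2 p1"
      and B2: "beta X (Suc i) * beta ?X2 (Suc i) = 1 + cd p2 p3 * cd p3 p2"
      using beta_mult[OF X j(1,2)] beta_mult[OF X j(3,4)] by simp_all
    \<comment> \<open>Both paths to \<open>?X121\<close> exchange the same three pairs of nodes, in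
      opposite order. If \<open>?X121\<close> is not standard, the last factor on each path is
      0.\<close>
    have BCD: "beta X i * beta ?X1 (Suc i) * beta ?X12 i = beta X (Suc i) * beta ?X2 i * beta ?X21 (Suc i)"
    proof (cases "?X121 \<in> ST")
      case True
      note std = all_std[OF True]
      show ?thesis using X std True by (simp add: beta_def swap_braid[symmetric])
    next
      case False
      then have "beta ?X12 i = 0" "beta ?X21 (Suc i) = 0"
        by (simp_all add: beta_def swap_braid[symmetric])
      then show ?thesis by simp
    qed
    note V_Sigma' = V_Sigma[OF j(1,2) f] V_Sigma[OF j(3,4) f]
      V_Sigma[OF j(1,2) V_supported[OF g(2)]] V_Sigma[OF j(3,4) V_supported[OF g(1)]]
    show ?thesis
      unfolding Suc_eq_plus1[symmetric] V_Sigma' alpha_def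
        \<open>nd X i = p1\<close> \<open>nd X (Suc i) = p2\<close> \<open>nd X (Suc (Suc i)) = p3\<close> 1 2 12 21 swap_swap
        swap_braid[symmetric]
      by (rule braid_coefficients[OF coef_diag_triple[OF sep] coef_diag_triple'[OF sep] B1 B2 BCD])
  next
    case False
    then show ?thesis using j by (simp add: V_op_Sigma del: V_op.simps)
  qed
qed

lemma swap_commute: "i + 1 < j \<Longrightarrow> swap i (swap j X) = swap j (swap i X)"
  by (auto simp: swap_def fun_eq_iff Transposition.transpose_def)

lemma swap_std_far:
  assumes i: "1 \<le> i" "i < n" "1 \<le> j" "j < n" "i + 1 < j \<or> j + 1 < i"
    and X: "X \<in> ST" and Z: "swap i (swap j X) \<in> ST"
  shows "swap i X \<in> ST"
proof (rule swap_std[OF X i(1,2) Z])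
  have "X (nd X i) = i" "X (nd X (i + 1)) = i + 1"
    using i by (auto intro!: entry_node_of[OF X])
  then show "swap i (swap j X) (nd X (i + 1)) < swap i (swap j X) (nd X i)"
    using i by (auto simp: swap_def Transposition.transpose_def)
qed

lemma V_commute:
  assumes i: "1 \<le> i" "i < n" "1 \<le> j" "j < n" "i + 1 < j" and f: "f \<in> supported ST"
  shows "V (Sigma i) (V (Sigma j) f) = V (Sigma j) (V (Sigma i) f)"
proof
  fix X
  have g: "Sigma i \<in> hgens n" "Sigma j \<in> hgens n" using i by (auto simp: hgens_def)
  show "V (Sigma i) (V (Sigma j) f) X = V (Sigma j) (V (Sigma i) f) X"
  proof (cases "X \<in> ST")
    case X: True
    have al: "alpha (swap i X) j = alpha X j" "alpha (swap j X) i = alpha X i"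
      using i node_of_swap_simps[OF std_bij[OF X]] by (auto simp: alpha_def)
    have nd: "nd (swap i X) j = nd X j" "nd (swap i X) (j + 1) = nd X (j + 1)"
      "nd (swap j X) i = nd X i" "nd (swap j X) (i + 1) = nd X (i + 1)"
      using i node_of_swap_simps[OF std_bij[OF X]] by auto
    have sw: "swap i (swap j X) = swap j (swap i X)"
      using i(5) by (rule swap_commute)
    have be: "beta X i * beta (swap i X) j = beta X j * beta (swap j X) i"
    proof (cases "swap i (swap j X) \<in> ST")
      case True
      have "swap i X \<in> ST" by (rule swap_std_far[OF i(1-4) _ X True]) (use i in simp)
      moreover have "swap j X \<in> ST"
        by (rule swap_std_far[OF i(3,4,1,2) _ X]) (use i True sw in simp_all)
      ultimately show ?thesis using X True nd by (simp add: beta_def sw)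
    next
      case False
      then show ?thesis by (simp add: beta_def sw)
    qed
    have "x * (y * f0 + b * f1) + b' * (y * f2 + c * f3) = y * (x * f0 + b' * f2) + b * (x * f1 + c' * f3)"
      if "b' * c = b * c'" for x y b b' c c' f0 f1 f2 f3 :: 'k
    proof -
      have "b' * (c * f3) = b * (c' * f3)" using that by (simp flip: mult.assoc)
      then show ?thesis by (simp add: algebra_simps)
    qed
    note * = this[OF be]
    note V_Sigma' = V_Sigma[OF i(1,2) f] V_Sigma[OF i(3,4) f]
      V_Sigma[OF i(1,2) V_supported[OF g(2)]] V_Sigma[OF i(3,4) V_supported[OF g(1)]]
    show ?thesis
      unfolding V_Sigma' al sw by (rule *)
  next
    case False
    then show ?thesis using i by (simp add: V_op_Sigma del: V_op.simps)
  qed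
qed

lemma Tau_in_hgens: "Tau \<in> hgens n"
  by (simp add: hgens_def)

lemma V_Tau_commute:
  assumes i: "1 < i" "i < n" and f: "f \<in> supported ST"
  shows "V Tau (V (Sigma i) f) = V (Sigma i) (V Tau f)"
proof
  fix X
  have g: "Sigma i \<in> hgens n" using i by (auto simp: hgens_def)
  show "V Tau (V (Sigma i) f) X = V (Sigma i) (V Tau f) X"
  proof (cases "X \<in> ST")
    case X: True
    have "nd (swap i X) 1 = nd X 1"
      using i node_of_swap_simps[OF std_bij[OF X]] by auto
    then show ?thesis
      using i by (simp add: V_Sigma V_Tau f V_supported g Tau_in_hgens algebra_simps del: V_op.simps)
  next
    case False
    then show ?thesis using i by (simp add: V_op_Sigma V_op_Tau del: V_op.simps)
  qed
qed

lemma V_Tau_braid: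
  assumes n: "1 < n" and f: "f \<in> supported ST"
  shows "V Tau (V (Sigma 1) (V Tau (V (Sigma 1) f))) = V (Sigma 1) (V Tau (V (Sigma 1) (V Tau f)))"
proof
  fix X
  have g: "Sigma 1 \<in> hgens n" using n by (auto simp: hgens_def)
  show "V Tau (V (Sigma 1) (V Tau (V (Sigma 1) f))) X = V (Sigma 1) (V Tau (V (Sigma 1) (V Tau f))) X"
  proof (cases "X \<in> ST")
    case X: True
    define a a' c c' b b' where "a = cd (nd X 1) (nd X 2)" and "a' = cd (nd X 2) (nd X 1)"
      and "c = ct (nd X 1)" and "c' = ct (nd X 2)" and "b = beta X 1" and "b' = beta (swap 1 X) 1"
    have nd: "nd (swap 1 X) 1 = nd X 2" "nd (swap 1 X) 2 = nd X 1"
      using n node_of_swap_simps[OF std_bij[OF X], of 1] by (auto simp: numeral_2_eq_2)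
    have al: "alpha X 1 = a" "alpha (swap 1 X) 1 = a'"
      using nd by (auto simp: alpha_def a_def a'_def one_add_one[symmetric] simp del: one_add_one)
    have z: "(c - c') * (c * a + c' * a') = 0"
      unfolding a_def a'_def c_def c'_def using n by (intro coef_diag_content separated_near[OF X]) auto
    \<comment> \<open>The diagonal entries of the two sides agree, and the off-diagonal entries
      differ by the expression of \<open>coef_diag_content\<close>.\<close>
    have "c * (a * (c * (a * f X + b * f (swap 1 X))) + b * (c' * (a' * f (swap 1 X) + b' * f X)))
      - (a * (c * (a * (c * f X) + b * (c' * f (swap 1 X)))) + b * (c' * (a' * (c' * f (swap 1 X)) + b' * (c * f X))))
      = b * f (swap 1 X) * ((c - c') * (c * a + c' * a'))"
      by (simp add: algebra_simps)
    then have "c * (a * (c * (a * f X + b * f (swap 1 X))) + b * (c' * (a' * f (swap 1 X) + b' * f X)))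
      = a * (c * (a * (c * f X) + b * (c' * f (swap 1 X)))) + b * (c' * (a' * (c' * f (swap 1 X)) + b' * (c * f X)))"
      using z by simp
    then show ?thesis
      using n by (simp add: V_Sigma V_Tau f V_supported g Tau_in_hgens al nd
          flip: c_def c'_def b_def b'_def del: V_op.simps One_nat_def)
  next
    case False
    then show ?thesis using n by (simp add: V_op_Sigma V_op_Tau del: V_op.simps One_nat_def)
  qed
qed

text \<open>The entry 1 occupies the upper left corner of its diagram, where the diagonal is 0.
  Hence the eigenvalues of \<open>Tau\<close> are among the roots in the cyclotomic
  relation.\<close>

lemma content_first:
  assumes "X \<in> ST" "1 \<le> n"
  shows "ct (nd X 1) = v (fst (nd X 1))"
proof -
  obtain k r s where p: "nd X 1 = (k, r, s)" by (cases "nd X 1")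
  have m: "(k, r, s) \<in> nodes lam" and e: "X (k, r, s) = 1"
    using node_of_in[OF assms(1), of 1] entry_node_of[OF assms(1), of 1] assms(2) p by auto
  have "(k, 1, 1) \<in> nodes lam"
    by (rule nodes_down[OF partition m]) (use m in \<open>auto simp: nodes_def\<close>)
  moreover have "r \<ge> 1" "s \<ge> 1" using m by (auto simp: nodes_def)
  ultimately have "r = 1 \<and> s = 1"
    using std_less[OF assms(1), of k 1 1 r s] m e entry_range[OF assms(1), of "(k, 1, 1)"] by fastforce
  then show ?thesis by (simp add: content_def p del: One_nat_def)
qed

sublocale V: linear_ops V by (rule linear_ops_V)

lemma V_cyclotomic:
  assumes n: "1 \<le> n" and f: "f \<in> supported ST"
  shows "free_act V (prod_list (map (\<lambda>j. \<tau> - scal (v j)) (sorted_list_of_set UNIV))) f = 0"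
proof -
  have *: "free_act V (prod_list (map (\<lambda>j. \<tau> - scal (v j)) js)) f
      = (\<lambda>X. (\<Prod>j\<leftarrow>js. ct (nd X 1) - v j) * f X)" for js
  proof (induction js)
    case Nil
    then show ?case by (simp add: V.free_act_one)
  next
    case (Cons j js)
    have s: "(\<lambda>X. (\<Prod>j\<leftarrow>js. ct (nd X 1) - v j) * f X) \<in> supported ST"
      using f by (auto simp: supported_def)
    show ?case
      unfolding list.map prod_list.Cons V.free_act_mult Cons.IH V.free_act_diff V.free_act_gen V.free_act_scal
      by (simp add: fun_eq_iff V_Tau[OF s] fscale_def left_diff_distrib mult.assoc del: V_op.simps One_nat_def)
  qed
  have "(\<Prod>j\<leftarrow>sorted_list_of_set UNIV. ct (nd X 1) - v j) * f X = 0" for X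
  proof (cases "X \<in> ST")
    case True
    then show ?thesis using content_first[OF True n] by (auto simp: prod_list_zero_iff)
  next
    case False
    then show ?thesis using f by (simp add: supported_def)
  qed
  then show ?thesis unfolding * by auto
qed

lemma hecke_rep_V:
  assumes "1 \<le> n"
  shows "hecke_rep n q v ST V"
proof
  fix x :: "'k freealg" and f :: "'m filling \<Rightarrow> 'k"
  assume x: "x \<in> hecke_relators n q v" and f: "f \<in> supported ST"
  have far: "V (Sigma i) (V (Sigma j) f) = V (Sigma j) (V (Sigma i) f)"
    if "1 \<le> i" "i < n" "1 \<le> j" "j < n" "1 < \<bar>int i - int j\<bar>" for i j
    using V_commute[of i j f] V_commute[of j i f] f that by (cases "i < j") auto
  show "free_act V x f = 0"
    using x f V_braid far V_Tau_braid V_Tau_commute V_quadratic V_cyclotomic[OF assms]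
    unfolding hecke_relators_def
    by (auto simp: V.free_act_simps mult.assoc simp del: V_op.simps One_nat_def split: if_splits)
qed (use V_supported in auto)

end

section \<open>Baxterised generators\<close>

lemma bvec_expansion:
  assumes "finite B" "f \<in> supported B"
  shows "f = (\<Sum>b\<in>B. fscale (f b) (bvec b))"
proof
  fix x
  have "(\<Sum>b\<in>B. fscale (f b) (bvec b)) x = (\<Sum>b\<in>B. if b = x then f x else 0)"
    by (auto simp: sum_fun_apply fscale_def bvec_def intro!: sum.cong)
  then show "f x = (\<Sum>b\<in>B. fscale (f b) (bvec b)) x"
    using assms by (auto simp: supported_def)
qed

lemma dim_supported:
  assumes "finite B"
  shows "fun_vs.dim (supported B :: ('b \<Rightarrow> 'k::field) set) = card B"
proof -
  have inj: "inj_on (bvec :: 'b \<Rightarrow> 'b \<Rightarrow> 'k) B"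
    by (auto simp: inj_on_def bvec_def fun_eq_iff split: if_splits)
  have fin: "finite ((bvec :: 'b \<Rightarrow> 'b \<Rightarrow> 'k) ` B)" using assms by simp
  have "fun_vs.independent ((bvec :: 'b \<Rightarrow> 'b \<Rightarrow> 'k) ` B)"
  proof (rule fun_vs.independent_if_scalars_zero[OF fin])
    fix u :: "('b \<Rightarrow> 'k) \<Rightarrow> 'k" and y :: "'b \<Rightarrow> 'k"
    assume s: "(\<Sum>x\<in>bvec ` B. fscale (u x) x) = 0" and y: "y \<in> bvec ` B"
    then obtain b where b: "y = bvec b" "b \<in> B" by blast
    have "0 = (\<Sum>x\<in>B. fscale (u (bvec x)) (bvec x)) b"
      using s by (simp add: sum.reindex[OF inj])
    also have "\<dots> = (\<Sum>x\<in>B. if x = b then u (bvec b) else 0)"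
      by (auto simp: sum_fun_apply fscale_def bvec_def intro!: sum.cong)
    finally show "u y = 0" using b assms by simp
  qed
  moreover have "fun_vs.span ((bvec :: 'b \<Rightarrow> 'b \<Rightarrow> 'k) ` B) = supported B"
  proof (rule antisym)
    show "fun_vs.span (bvec ` B) \<subseteq> (supported B :: ('b \<Rightarrow> 'k) set)"
      by (rule fun_vs.span_minimal[OF _ subspace_supported]) (auto simp: supported_def bvec_def)
    show "supported B \<subseteq> fun_vs.span ((bvec :: 'b \<Rightarrow> 'b \<Rightarrow> 'k) ` B)"
    proof
      fix f :: "'b \<Rightarrow> 'k" assume "f \<in> supported B"
      then have "f = (\<Sum>b\<in>B. fscale (f b) (bvec b))" by (rule bvec_expansion[OF assms])
      also have "\<dots> \<in> fun_vs.span (bvec ` B)"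
        by (intro fun_vs.span_sum fun_vs.span_scale fun_vs.span_base imageI)
      finally show "f \<in> fun_vs.span (bvec ` B)" .
    qed
  qed
  ultimately show ?thesis
    using fun_vs.dim_span_eq_card_independent card_image[OF inj] by metis
qed

locale seminormal_pair = L: seminormal n lam q v + R: seminormal n lam' q v
  for n :: nat and lam lam' :: "'m::{finite,linorder} \<Rightarrow> nat list"
    and q :: "'k::field" and v :: "'m \<Rightarrow> 'k"
begin

abbreviation "ST \<equiv> std_tableaux n lam"
abbreviation "ST' \<equiv> std_tableaux n lam'"
abbreviation "nd \<equiv> node_of lam"
abbreviation "V' \<equiv> V_op n q v lam'"
abbreviation "T \<equiv> T_op n q v lam lam'"
abbreviation "S' \<equiv> (supported ST' :: ('m filling \<Rightarrow> 'k) set)"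

text \<open>The operators \<open>rop i p p'\<close> are the Baxterised generators: they are inverse to each other up to a
  scalar and satisfy the Yang-Baxter equation with spectral parameters the contents of the nodes.\<close>

definition rop :: "nat \<Rightarrow> 'm node \<Rightarrow> 'm node \<Rightarrow> ('m filling \<Rightarrow> 'k) \<Rightarrow> 'm filling \<Rightarrow> 'k" where
  "rop i p p' w = V' (Sigma i) w + fscale (coef_shift q v p p') w"

definition rmat :: "'m filling \<Rightarrow> nat \<Rightarrow> ('m filling \<Rightarrow> 'k) \<Rightarrow> 'm filling \<Rightarrow> 'k" where
  "rmat X i = rop i (nd X i) (nd X (i + 1))"

lemma Sigma_in_hgens: "1 \<le> i \<Longrightarrow> i < n \<Longrightarrow> Sigma i \<in> hgens n"
  by (auto simp: hgens_def)

lemma rop_supported: "1 \<le> i \<Longrightarrow> i < n \<Longrightarrow> w \<in> S' \<Longrightarrow> rop i p p' w \<in> S'"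
  unfolding rop_def
  by (intro fun_vs.subspace_add fun_vs.subspace_scale subspace_supported R.V_supported Sigma_in_hgens)

lemma rop_add: "rop i p p' (w + w') = rop i p p' w + rop i p p' w'"
  unfolding rop_def by (simp only: R.V.T_add fun_vs.scale_right_distrib add_ac)

lemma rop_scale: "rop i p p' (fscale c w) = fscale c (rop i p p' w)"
  unfolding rop_def by (simp only: R.V.T_scale fun_vs.scale_right_distrib fun_vs.scale_left_commute[of c])

text \<open>With \<open>x + y = q - inverse q\<close> the two operators are the generator minus
  \<open>y\<close> and minus \<open>x\<close>. The quadratic relation makes their product the scalar
  \<open>1 + x * y\<close>, the same determinant as in the seminormal blocks.\<close>

lemma rop_rop:
  assumes i: "1 \<le> i" "i < n" and w: "w \<in> S'" and sep: "separated q v p p'"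
  shows "rop i p' p (rop i p p' w) = fscale (coef_swap q v p p' * coef_swap q v p' p) w"
proof
  fix Y
  define s where "s = V' (Sigma i) w"
  define x y Q where "x = coef_diag q v p p'" and "y = coef_diag q v p' p" and "Q = q - inverse q"
  have xy: "x + y = Q"
    using coef_diag_add[OF sep] by (simp add: x_def y_def Q_def)
  have "V' (Sigma i) s = fscale Q s + w"
    unfolding s_def Q_def by (rule R.V_quadratic[OF i w])
  then have "rop i p' p (rop i p p' w) Y
      = Q * s Y + w Y + coef_shift q v p p' * s Y + coef_shift q v p' p * (s Y + coef_shift q v p p' * w Y)"
    unfolding rop_def R.V.T_add R.V.T_scale s_def[symmetric] by (simp add: fscale_def)
  also have "\<dots> = Q * s Y + w Y - y * s Y - x * (s Y - y * w Y)"
    using sep by (simp add: coef_shift_eq separated_commute[of q v p'] flip: x_def y_def)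
  also have "\<dots> = (1 + x * y) * w Y"
    unfolding xy[symmetric] by (simp add: algebra_simps)
  also have "1 + x * y = coef_swap q v p p' * coef_swap q v p' p"
    using coef_swap_mult[OF sep L.q_nonzero] by (simp add: x_def y_def)
  finally show "rop i p' p (rop i p p' w) Y = fscale (coef_swap q v p p' * coef_swap q v p' p) w Y"
    by (simp add: fscale_def)
qed

lemma rop_yang_baxter:
  assumes i: "1 \<le> i" "i + 1 < n" and w: "w \<in> S'"
    and sep: "separated q v p1 p2" "separated q v p2 p3" "separated q v p1 p3"
  shows "rop i p2 p3 (rop (i + 1) p1 p3 (rop i p1 p2 w)) = rop (i + 1) p1 p2 (rop i p1 p3 (rop (i + 1) p2 p3 w))"
proof
  fix Y
  define e where "e = coef_shift q v"
  define Q where "Q = q - inverse q"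
  define s t st ts where "s = V' (Sigma i) w" and "t = V' (Sigma (i + 1)) w"
    and "st = V' (Sigma i) t" and "ts = V' (Sigma (i + 1)) s"
  have ss: "V' (Sigma i) s = fscale Q s + w" and tt: "V' (Sigma (i + 1)) t = fscale Q t + w"
    unfolding s_def t_def Q_def using i by (auto intro!: R.V_quadratic w simp del: V_op.simps)
  have sts: "V' (Sigma i) ts = V' (Sigma (i + 1)) st"
    unfolding s_def t_def st_def ts_def using R.V_braid[OF i w] .
  have e': "e p1 p2 = - coef_diag q v p2 p1" "e p2 p3 = - coef_diag q v p3 p2" "e p1 p3 = - coef_diag q v p3 p1"
    unfolding e_def using sep by (auto intro!: coef_shift_eq)
  \<comment> \<open>Since \<open>coef_shift\<close> reverses each pair of nodes, the identity is
    taken for the reversed triple \<open>p3\<close>, \<open>p2\<close>, \<open>p1\<close>.\<close>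
  have triple: "coef_diag q v p3 p2 * coef_diag q v p2 p1 + coef_diag q v p3 p1 * coef_diag q v p2 p3
      = coef_diag q v p2 p1 * coef_diag q v p3 p1"
    using sep by (intro coef_diag_triple) (auto simp: separated_commute)
  have add: "coef_diag q v p2 p3 = Q - coef_diag q v p3 p2"
    using coef_diag_add[OF sep(2)] by (simp add: Q_def algebra_simps)
  have key: "e p2 p3 * e p1 p2 = e p1 p3 * (Q + e p1 p2 + e p2 p3)"
    using triple unfolding e' add by (simp add: algebra_simps)
  \<comment> \<open>After the braid and quadratic relations only a multiple of the difference of the
    two generators applied to \<open>w\<close> is left.\<close>
  have "rop i p2 p3 (rop (i + 1) p1 p3 (rop i p1 p2 w)) Y - rop (i + 1) p1 p2 (rop i p1 p3 (rop (i + 1) p2 p3 w)) Y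
     = (e p1 p3 * (Q + e p1 p2 + e p2 p3) - e p2 p3 * e p1 p2) * (s Y - t Y)"
    unfolding rop_def R.V.T_add R.V.T_scale
      e_def[symmetric] s_def[symmetric] t_def[symmetric] st_def[symmetric] ts_def[symmetric] ss tt sts
    by (simp add: fscale_def algebra_simps del: V_op.simps)
  then show "rop i p2 p3 (rop (i + 1) p1 p3 (rop i p1 p2 w)) Y = rop (i + 1) p1 p2 (rop i p1 p3 (rop (i + 1) p2 p3 w)) Y"
    using key by simp
qed

lemma rop_commute:
  assumes i: "1 \<le> i" "i < n" "1 \<le> j" "j < n" "i + 1 < j \<or> j + 1 < i" and w: "w \<in> S'"
  shows "rop i p1 p2 (rop j p3 p4 w) = rop j p3 p4 (rop i p1 p2 w)"
proof -
  have "V' (Sigma i) (V' (Sigma j) w) = V' (Sigma j) (V' (Sigma i) w)"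
    using i R.V_commute[of i j w] R.V_commute[of j i w] w by (auto simp del: V_op.simps)
  then show ?thesis
    unfolding rop_def R.V.T_add R.V.T_scale fun_vs.scale_right_distrib
    by (simp only: add_ac fun_vs.scale_scale mult.commute)
qed

text \<open>A fixed standard tableau orders the nodes. Exchanging the entries at a descent with respect to it
  keeps a tableau standard, because an entry can be blocked only by a neighbour that is smaller
  in every standard tableau.\<close>

definition ref :: "'m filling" where
  "ref = (SOME X. X \<in> ST)"

definition descent :: "'m filling \<Rightarrow> nat \<Rightarrow> bool" where
  "descent X i \<longleftrightarrow> X \<in> ST \<and> 1 \<le> i \<and> i < n \<and> ref (nd X (i + 1)) < ref (nd X i)"

text \<open>A termination measure in the spirit of the rearrangement inequality: exchanging at a
  descent moves the larger entry to the node with the larger value of \<open>ref\<close>, whose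
  weight \<open>n - ref p\<close> is smaller.\<close>

definition disorder :: "'m filling \<Rightarrow> nat" where
  "disorder X = (\<Sum>p\<in>nodes lam. X p * (n - ref p))"

lemma ref_std: "X \<in> ST \<Longrightarrow> ref \<in> ST"
  unfolding ref_def by (rule someI[of "\<lambda>X. X \<in> ST"])

lemma descent_swap_std: "descent X i \<Longrightarrow> swap i X \<in> ST"
  using L.swap_std ref_std by (auto simp: descent_def)

lemma disorder_swap:
  assumes "descent X i"
  shows "disorder (swap i X) < disorder X"
proof -
  define p p' where "p = nd X i" and "p' = nd X (i + 1)"
  have X: "X \<in> ST" and i: "1 \<le> i" "i < n" and less: "ref p' < ref p"
    using assms by (auto simp: descent_def p_def p'_def)
  have p: "p \<in> nodes lam" "p' \<in> nodes lam" "X p = i" "X p' = i + 1"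
    using X i unfolding p_def p'_def by (auto intro!: L.node_of_in simp: L.entry_node_of)
  have split: "(\<Sum>x\<in>nodes lam. g x) = g p + (g p' + (\<Sum>x\<in>nodes lam - {p} - {p'}. g x))" for g :: "'m node \<Rightarrow> nat"
    using p L.finite_nodes[OF X] less
    by (subst sum.remove[of _ p]) (auto intro!: sum.remove)
  have "(\<Sum>x\<in>nodes lam - {p} - {p'}. swap i X x * (n - ref x)) = (\<Sum>x\<in>nodes lam - {p} - {p'}. X x * (n - ref x))"
  proof (intro sum.cong refl)
    fix x assume x: "x \<in> nodes lam - {p} - {p'}"
    then have "X x \<noteq> i" "X x \<noteq> i + 1"
      using L.node_of_entry[OF X, of x] by (auto simp: p_def p'_def)
    then show "swap i X x * (n - ref x) = X x * (n - ref x)" by (simp add: swap_def)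
  qed
  moreover have "ref p \<le> n" using L.entry_range[OF ref_std[OF X] p(1)] by simp
  then have "n - ref p < n - ref p'" using less by simp
  moreover have "(i + 1) * a + (i * b + s) < i * a + ((i + 1) * b + s)" if "a < b" for a b s :: nat
    using that by simp
  moreover have "swap i X p = i + 1" "swap i X p' = i" using p by (simp_all add: swap_def)
  ultimately show ?thesis
    unfolding disorder_def split using p by simp
qed

definition some_descent :: "'m filling \<Rightarrow> nat" where
  "some_descent X = (SOME i. descent X i)"

lemma some_descent: "descent X i \<Longrightarrow> descent X (some_descent X)"
  unfolding some_descent_def by (rule someI)

text \<open>\<open>untwist X\<close> is a composite of Baxterised generators along a path of descents starting at \<open>X\<close>.
  Its independence of the path, \<open>untwist_descent\<close>, follows from local confluence: two
  descents either commute or are adjacent, and then the Yang-Baxter equation applies.\<close>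

function untwist :: "'m filling \<Rightarrow> ('m filling \<Rightarrow> 'k) \<Rightarrow> 'm filling \<Rightarrow> 'k" where
  "untwist X w =
     (if \<exists>i. descent X i
      then fscale (inverse (coef_swap q v (nd X (some_descent X)) (nd X (some_descent X + 1))))
             (untwist (swap (some_descent X) X) (rmat X (some_descent X) w))
      else w)"
  by auto
termination
  by (relation "measure (\<lambda>(X, w). disorder X)") (auto intro: disorder_swap some_descent)

declare untwist.simps [simp del]

text \<open>The recursion of \<open>untwist\<close> taken at an arbitrary descent instead of
  \<open>some_descent\<close>; path independence is the equality of the two.\<close>

definition step :: "'m filling \<Rightarrow> nat \<Rightarrow> ('m filling \<Rightarrow> 'k) \<Rightarrow> 'm filling \<Rightarrow> 'k" where
  "step X i w = fscale (inverse (coef_swap q v (nd X i) (nd X (i + 1)))) (untwist (swap i X) (rmat X i w))"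

lemma untwist_some_descent: "descent X i \<Longrightarrow> untwist X w = step X (some_descent X) w"
  unfolding step_def by (subst untwist.simps) auto

lemma untwist_no_descent: "\<nexists>i. descent X i \<Longrightarrow> untwist X w = w"
  by (subst untwist.simps) auto

lemma descent_bounds: "descent X i \<Longrightarrow> X \<in> ST \<and> 1 \<le> i \<and> i < n"
  by (simp add: descent_def)

lemma rmat_supported: "descent X i \<Longrightarrow> w \<in> S' \<Longrightarrow> rmat X i w \<in> S'"
  unfolding rmat_def by (auto dest: descent_bounds intro!: rop_supported)

lemma separated_step: "X \<in> ST \<Longrightarrow> 1 \<le> i \<Longrightarrow> i < n \<Longrightarrow> separated q v (nd X i) (nd X (i + 1))"
  by (intro L.separated_near) auto

section \<open>Linearity and invertibility of the untwisting operators\<close>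

lemma untwist_add: "untwist X (w + w') = untwist X w + untwist X w'"
proof (induction X w arbitrary: w' rule: untwist.induct)
  case (1 X w)
  show ?case
  proof (cases "\<exists>i. descent X i")
    case True
    then obtain i where i: "descent X i" by blast
    show ?thesis
      unfolding untwist_some_descent[OF i] step_def rmat_def rop_add
      using 1[OF True] by (simp only: rmat_def fun_vs.scale_right_distrib)
  next
    case False
    show ?thesis unfolding untwist_no_descent[OF False] ..
  qed
qed

lemma untwist_scale: "untwist X (fscale c w) = fscale c (untwist X w)"
proof (induction X w rule: untwist.induct)
  case (1 X w)
  show ?case
  proof (cases "\<exists>i. descent X i")
    case True
    then obtain i where i: "descent X i" by blast
    show ?thesis
      unfolding untwist_some_descent[OF i] step_def rmat_def rop_scale
      using 1[OF True] by (simp only: rmat_def fun_vs.scale_left_commute)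
  next
    case False
    show ?thesis unfolding untwist_no_descent[OF False] ..
  qed
qed

lemma untwist_zero: "untwist X 0 = 0"
  using untwist_scale[of X 0 0] by simp

lemma bij_fscale: "c \<noteq> 0 \<Longrightarrow> bij_betw (fscale c) S' S'"
  by (rule bij_betw_byWitness[where f' = "fscale (inverse c)"])
     (auto simp: fscale_def supported_def fun_eq_iff)

text \<open>By \<open>rop_rop\<close> the operator with the nodes exchanged is an inverse up to the
  scalar \<open>c\<close>. Its two factors are the swap coefficients of \<open>X\<close> and of
  \<open>swap i X\<close>, nonzero because both tableaux are standard.\<close>

lemma bij_rmat:
  assumes "descent X i"
  shows "bij_betw (rmat X i) S' S'"
proof -
  have X: "X \<in> ST" and i: "1 \<le> i" "i < n" using descent_bounds[OF assms] by auto
  have Y: "swap i X \<in> ST" using descent_swap_std[OF assms] .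
  let ?p = "nd X i" and ?p' = "nd X (i + 1)"
  have sep: "separated q v ?p ?p'" by (rule separated_step[OF X i])
  then have sep': "separated q v ?p' ?p" by (simp only: separated_commute)
  have nd: "nd (swap i X) i = ?p'" "nd (swap i X) (i + 1) = ?p"
    using L.node_of_swap_simps[OF L.std_bij[OF X] i] by auto
  define c where "c = coef_swap q v ?p ?p' * coef_swap q v ?p' ?p"
  have "c \<noteq> 0"
    using L.coef_swap_nonzero[OF X i Y] L.coef_swap_nonzero[OF Y i] X nd by (simp add: c_def)
  have c': "coef_swap q v ?p' ?p * coef_swap q v ?p ?p' = c" by (simp add: c_def)
  show ?thesis
  proof (rule bij_betw_byWitness[where f' = "\<lambda>w. fscale (inverse c) (rop i ?p' ?p w)"])
    show "\<forall>w\<in>S'. fscale (inverse c) (rop i ?p' ?p (rmat X i w)) = w"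
      using rop_rop[OF i _ sep, folded c_def] \<open>c \<noteq> 0\<close> by (simp add: rmat_def)
    show "\<forall>w\<in>S'. rmat X i (fscale (inverse c) (rop i ?p' ?p w)) = w"
      using rop_rop[OF i _ sep'] \<open>c \<noteq> 0\<close> unfolding c' by (simp add: rmat_def rop_scale)
    show "rmat X i ` S' \<subseteq> S'" using rmat_supported[OF assms] by blast
    show "(\<lambda>w. fscale (inverse c) (rop i ?p' ?p w)) ` S' \<subseteq> S'"
      by (intro image_subsetI fun_vs.subspace_scale subspace_supported rop_supported[OF i])
  qed
qed

lemma bij_untwist: "bij_betw (untwist X) S' S'"
proof (induction "disorder X" arbitrary: X rule: less_induct)
  case less
  show ?case
  proof (cases "\<exists>i. descent X i")
    case True
    define i where "i = some_descent X"
    have i: "descent X i" using True some_descent by (auto simp: i_def)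
    have eq: "untwist X = fscale (inverse (coef_swap q v (nd X i) (nd X (i + 1)))) \<circ> (untwist (swap i X) \<circ> rmat X i)"
      unfolding i_def using True by (auto simp: fun_eq_iff untwist_some_descent step_def)
    have "coef_swap q v (nd X i) (nd X (i + 1)) \<noteq> 0"
      using L.coef_swap_nonzero descent_bounds[OF i] descent_swap_std[OF i] by blast
    then have "bij_betw (fscale (inverse (coef_swap q v (nd X i) (nd X (i + 1))))) S' S'"
      by (intro bij_fscale) simp
    then show ?thesis
      unfolding eq by (intro bij_betw_trans[OF bij_betw_trans[OF bij_rmat[OF i] less[OF disorder_swap[OF i]]]])
  next
    case False
    then have "untwist X = id" by (auto simp: fun_eq_iff untwist_no_descent)
    then show ?thesis by simp
  qed
qed

lemma untwist_supported: "w \<in> S' \<Longrightarrow> untwist X w \<in> S'"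
  using bij_untwist by (auto simp: bij_betw_def)

section \<open>Independence of the path of descents\<close>

lemma node_of_swap_std:
  assumes "X \<in> ST" "1 \<le> i" "i < n"
  shows "nd (swap i X) i = nd X (i + 1)" "nd (swap i X) (i + 1) = nd X i"
    and "j \<in> {1..n} \<Longrightarrow> j \<noteq> i \<Longrightarrow> j \<noteq> i + 1 \<Longrightarrow> nd (swap i X) j = nd X j"
  using L.node_of_swap_simps[OF L.std_bij[OF assms(1)] assms(2,3)] by auto

text \<open>The square: each of the two distant descents survives the other exchange, so
  \<open>IH\<close> at the two intermediate tableaux leads both sides to the same corner.\<close>

lemma step_commute:
  assumes IH: "\<And>Y i w. disorder Y < disorder X \<Longrightarrow> descent Y i \<Longrightarrow> w \<in> S' \<Longrightarrow> untwist Y w = step Y i w"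
    and i: "descent X i" and j: "descent X j" and ij: "i + 1 < j" and w: "w \<in> S'"
  shows "step X i w = step X j w"
proof -
  have X: "X \<in> ST" and b: "1 \<le> i" "i < n" "1 \<le> j" "j < n"
    using descent_bounds[OF i] descent_bounds[OF j] by auto
  have nd: "nd (swap i X) j = nd X j" "nd (swap i X) (j + 1) = nd X (j + 1)"
    "nd (swap j X) i = nd X i" "nd (swap j X) (i + 1) = nd X (i + 1)"
    using b ij node_of_swap_std(3)[OF X b(1,2), of j] node_of_swap_std(3)[OF X b(1,2), of "j + 1"]
      node_of_swap_std(3)[OF X b(3,4), of i] node_of_swap_std(3)[OF X b(3,4), of "i + 1"] by auto
  have d: "descent (swap i X) j" "descent (swap j X) i"
    using i j descent_swap_std[OF i] descent_swap_std[OF j] unfolding descent_def nd by auto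
  have "untwist (swap i X) (rmat X i w) = step (swap i X) j (rmat X i w)"
    by (rule IH[OF disorder_swap[OF i] d(1) rmat_supported[OF i w]])
  moreover have "untwist (swap j X) (rmat X j w) = step (swap j X) i (rmat X j w)"
    by (rule IH[OF disorder_swap[OF j] d(2) rmat_supported[OF j w]])
  moreover have "rmat (swap i X) j (rmat X i w) = rmat (swap j X) i (rmat X j w)"
    unfolding rmat_def nd by (rule rop_commute[OF b(3,4,1,2) _ w]) (use ij in simp)
  moreover have "swap j (swap i X) = swap i (swap j X)"
    using L.swap_commute[OF ij, of X] by (rule sym)
  ultimately show ?thesis
    unfolding step_def nd by (simp only: fun_vs.scale_scale mult.commute)
qed

text \<open>The hexagon: two adjacent descents mean that \<open>ref\<close> orders the three nodes
  in reverse, so every edge on both sides is again a descent and \<open>IH\<close> applies to each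
  intermediate tableau. Both sides collect the same three scalars.\<close>

lemma step_braid:
  assumes IH: "\<And>Y i w. disorder Y < disorder X \<Longrightarrow> descent Y i \<Longrightarrow> w \<in> S' \<Longrightarrow> untwist Y w = step Y i w"
    and i: "descent X i" and j: "descent X (i + 1)" and w: "w \<in> S'"
  shows "step X i w = step X (i + 1) w"
proof -
  let ?j = "i + 1"
  define p1 p2 p3 where "p1 = nd X i" and "p2 = nd X (i + 1)" and "p3 = nd X (i + 1 + 1)"
  have X: "X \<in> ST" and b: "1 \<le> i" "i < n" "1 \<le> i + 1" "i + 1 < n"
    using descent_bounds[OF i] descent_bounds[OF j] by auto
  have sep: "separated q v p1 p2" "separated q v p2 p3" "separated q v p1 p3"
    unfolding p1_def p2_def p3_def using b by (auto intro!: L.separated_near[OF X])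
  let ?X1 = "swap i X" and ?X2 = "swap (i + 1) X"
  let ?X12 = "swap (i + 1) ?X1" and ?X21 = "swap i ?X2"
  have less: "ref p2 < ref p1" "ref p3 < ref p2"
    using i j by (auto simp: descent_def p1_def p2_def p3_def)
  have X1: "?X1 \<in> ST" and X2: "?X2 \<in> ST"
    using descent_swap_std[OF i] descent_swap_std[OF j] .
  have 1: "nd ?X1 i = p2" "nd ?X1 (i + 1) = p1" "nd ?X1 (i + 1 + 1) = p3"
    unfolding p1_def p2_def p3_def using b node_of_swap_std(1,2)[OF X b(1,2)] node_of_swap_std(3)[OF X b(1,2), of "i + 1 + 1"] by auto
  have 2: "nd ?X2 i = p1" "nd ?X2 (i + 1) = p3" "nd ?X2 (i + 1 + 1) = p2"
    unfolding p1_def p2_def p3_def using b node_of_swap_std(1,2)[OF X b(3,4)] node_of_swap_std(3)[OF X b(3,4), of i] by auto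
  have d1: "descent ?X1 (i + 1)" and d2: "descent ?X2 i"
    using X1 X2 b less unfolding descent_def 1 2 by auto
  have X12: "?X12 \<in> ST" and X21: "?X21 \<in> ST"
    using descent_swap_std[OF d1] descent_swap_std[OF d2] .
  have 12: "nd ?X12 i = p2" "nd ?X12 (i + 1) = p3"
    using b 1 node_of_swap_std(1)[OF X1 b(3,4)] node_of_swap_std(3)[OF X1 b(3,4), of i] by simp_all
  have 21: "nd ?X21 (i + 1) = p1" "nd ?X21 (i + 1 + 1) = p2"
    using b 2 node_of_swap_std(2)[OF X2 b(1,2)] node_of_swap_std(3)[OF X2 b(1,2), of "i + 1 + 1"] by simp_all
  have d12: "descent ?X12 i" and d21: "descent ?X21 (i + 1)"
    using X12 X21 b less unfolding descent_def 12 21 by auto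
  note dis = disorder_swap[OF i] disorder_swap[OF j]
  note dis1 = less_trans[OF disorder_swap[OF d1] dis(1)] and dis2 = less_trans[OF disorder_swap[OF d2] dis(2)]
  have "step X i w = fscale (inverse (coef_swap q v p1 p2)) (untwist ?X1 (rop i p1 p2 w))"
    unfolding step_def rmat_def p1_def p2_def ..
  also have "untwist ?X1 (rop i p1 p2 w)
      = fscale (inverse (coef_swap q v p1 p3)) (untwist ?X12 (rop (i + 1) p1 p3 (rop i p1 p2 w)))"
    by (subst IH[OF dis(1) d1]) (simp_all only: step_def rmat_def 1 rop_supported[OF b(1,2) w])
  also have "untwist ?X12 (rop (i + 1) p1 p3 (rop i p1 p2 w))
      = fscale (inverse (coef_swap q v p2 p3)) (untwist (swap i ?X12) (rop i p2 p3 (rop (i + 1) p1 p3 (rop i p1 p2 w))))"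
    by (subst IH[OF dis1 d12])
       (simp_all only: step_def rmat_def 12 rop_supported[OF b(3,4) rop_supported[OF b(1,2) w]])
  finally have L: "step X i w = fscale (inverse (coef_swap q v p1 p2))
      (fscale (inverse (coef_swap q v p1 p3)) (fscale (inverse (coef_swap q v p2 p3))
        (untwist (swap i ?X12) (rop i p2 p3 (rop (i + 1) p1 p3 (rop i p1 p2 w))))))" .
  have "step X (i + 1) w = fscale (inverse (coef_swap q v p2 p3)) (untwist ?X2 (rop (i + 1) p2 p3 w))"
    unfolding step_def rmat_def p2_def p3_def ..
  also have "untwist ?X2 (rop (i + 1) p2 p3 w)
      = fscale (inverse (coef_swap q v p1 p3)) (untwist ?X21 (rop i p1 p3 (rop (i + 1) p2 p3 w)))"
    by (subst IH[OF dis(2) d2]) (simp_all only: step_def rmat_def 2 rop_supported[OF b(3,4) w])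
  also have "untwist ?X21 (rop i p1 p3 (rop (i + 1) p2 p3 w))
      = fscale (inverse (coef_swap q v p1 p2)) (untwist (swap (i + 1) ?X21) (rop (i + 1) p1 p2 (rop i p1 p3 (rop (i + 1) p2 p3 w))))"
    by (subst IH[OF dis2 d21])
       (simp_all only: step_def rmat_def 21 rop_supported[OF b(1,2) rop_supported[OF b(3,4) w]])
  finally have R: "step X (i + 1) w = fscale (inverse (coef_swap q v p2 p3))
      (fscale (inverse (coef_swap q v p1 p3)) (fscale (inverse (coef_swap q v p1 p2))
        (untwist (swap (i + 1) ?X21) (rop (i + 1) p1 p2 (rop i p1 p3 (rop (i + 1) p2 p3 w))))))" .
  have "swap i ?X12 = swap (i + 1) ?X21"
    using L.swap_braid[of i X] by simp
  moreover have "rop i p2 p3 (rop (i + 1) p1 p3 (rop i p1 p2 w)) = rop (i + 1) p1 p2 (rop i p1 p3 (rop (i + 1) p2 p3 w))"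
    by (rule rop_yang_baxter[OF b(1,4) w sep])
  ultimately show ?thesis
    unfolding L R by (simp only: fun_vs.scale_scale mult_ac)
qed

lemma untwist_descent: "descent X i \<Longrightarrow> w \<in> S' \<Longrightarrow> untwist X w = step X i w"
proof (induction "disorder X" arbitrary: X i w rule: less_induct)
  case less
  define k where "k = some_descent X"
  have k: "descent X k" unfolding k_def by (rule some_descent) (rule less.prems)
  consider "k = i" | "k + 1 < i" | "i + 1 < k" | "k = i + 1" | "i = k + 1" by linarith
  then have "step X k w = step X i w"
  proof cases
    case 2
    then show ?thesis by (intro step_commute less k)
  next
    case 3
    then show ?thesis by (intro step_commute[symmetric] less k)
  next
    case 4
    then show ?thesis using step_braid[OF less.hyps less.prems(1) _ less.prems(2)] k by simp
  next
    case 5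
    then show ?thesis using step_braid[OF less.hyps k _ less.prems(2)] less.prems(1) by simp
  qed simp
  then show ?case using untwist_some_descent[OF less.prems(1)] by (simp add: k_def)
qed

text \<open>Exactly one of \<open>X\<close> and \<open>swap i X\<close> has a descent at
  \<open>i\<close>. If it is \<open>swap i X\<close>, then \<open>untwist_descent\<close> is used
  there, and the two opposite Baxterised operators multiply to a scalar, one factor of which
  cancels.\<close>

lemma untwist_swap:
  assumes X: "X \<in> ST" and i: "1 \<le> i" "i < n" and Y: "swap i X \<in> ST" and w: "w \<in> S'"
  shows "untwist (swap i X) (rmat X i w) = fscale (coef_swap q v (nd X i) (nd X (i + 1))) (untwist X w)"
proof (cases "descent X i")
  case True
  show ?thesis
    unfolding untwist_descent[OF True w] step_def
    using L.coef_swap_nonzero[OF X i Y] by simp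
next
  case False
  let ?p = "nd X i" and ?p' = "nd X (i + 1)"
  have "ref ?p \<noteq> ref ?p'"
  proof
    assume "ref ?p = ref ?p'"
    moreover have "?p \<in> nodes lam" "?p' \<in> nodes lam"
      using X i by (auto intro!: L.node_of_in)
    ultimately have "?p = ?p'"
      using L.node_of_entry[OF ref_std[OF X], of ?p] L.node_of_entry[OF ref_std[OF X], of ?p'] by simp
    then show False
      using L.entry_node_of[OF X, of i] L.entry_node_of[OF X, of "i + 1"] i by simp
  qed
  note nd = node_of_swap_std(1,2)[OF X i]
  have d: "descent (swap i X) i"
    using False \<open>ref ?p \<noteq> ref ?p'\<close> X Y i unfolding descent_def nd by simp
  have nz: "coef_swap q v ?p' ?p \<noteq> 0"
    using L.coef_swap_nonzero[OF Y i] X unfolding nd L.swap_swap by simp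
  have "rmat X i w \<in> S'" unfolding rmat_def by (rule rop_supported[OF i w])
  then have "untwist (swap i X) (rmat X i w) = step (swap i X) i (rmat X i w)"
    by (rule untwist_descent[OF d])
  also have "\<dots> = fscale (inverse (coef_swap q v ?p' ?p)) (untwist X (rop i ?p' ?p (rop i ?p ?p' w)))"
    unfolding step_def rmat_def nd L.swap_swap ..
  also have "\<dots> = fscale (coef_swap q v ?p ?p') (untwist X w)"
    unfolding rop_rop[OF i w separated_step[OF X i]] untwist_scale using nz by simp
  finally show ?thesis .
qed

end

section \<open>The twisted tensor product\<close>

context seminormal_pair
begin

definition row :: "('m filling \<times> 'm filling \<Rightarrow> 'k) \<Rightarrow> 'm filling \<Rightarrow> 'm filling \<Rightarrow> 'k" where
  "row F X = (\<lambda>Y. F (X, Y))"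

lemma row_add: "row (F + G) X = row F X + row G X"
  and row_scale: "row (fscale c F) X = fscale c (row F X)"
  by (auto simp: row_def fscale_def)

lemma row_sum: "row (\<Sum>x\<in>A. F x) X = (\<Sum>x\<in>A. row (F x) X)"
  by (auto simp: row_def sum_fun_apply)

lemma row_tens: "row (tens u w) X = fscale (u X) w"
  by (auto simp: row_def tens_def fscale_def)

lemma sum_bvec:
  assumes "X \<in> ST"
  shows "(\<Sum>Z\<in>ST. fscale (bvec Z X) (g Z)) = (g X :: 'm filling \<Rightarrow> 'k)"
proof -
  have "(\<Sum>Z\<in>ST. fscale (bvec Z X) (g Z)) = (\<Sum>Z\<in>ST. if Z = X then g X else 0)"
    by (intro sum.cong refl) (simp add: bvec_def)
  then show ?thesis using assms by (simp add: L.finite_std)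
qed

lemma row_outside: "X \<notin> ST \<Longrightarrow> row (T g F) X = 0"
proof (cases g)
  case Tau
  assume "X \<notin> ST"
  then show ?thesis
    unfolding Tau T_op.simps Let_def row_sum row_scale row_tens
    by (intro sum.neutral ballI) (auto simp: bvec_def)
next
  case (Sigma i)
  assume "X \<notin> ST"
  then show ?thesis
    unfolding Sigma T_op.simps Let_def row_sum row_scale row_tens row_add
    by (intro sum.neutral ballI) (auto simp: bvec_def std_vec_def)
qed

lemma row_Tau:
  assumes "X \<in> ST"
  shows "row (T Tau F) X = fscale (L.ct (nd X 1)) (row F X)"
proof -
  have "row (T Tau F) X = (\<Sum>Z\<in>ST. fscale (bvec Z X) (fscale (L.ct (nd Z 1)) (row F Z)))"
    unfolding T_op.simps Let_def row_sum row_scale row_tens row_def[of F, symmetric]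
    by (intro sum.cong refl) (simp only: fun_vs.scale_scale mult.commute)
  then show ?thesis by (simp only: sum_bvec[OF assms])
qed

text \<open>Read at the target like \<open>V_op_Sigma\<close>; the operator on the incoming term
  belongs to the source \<open>swap i X\<close>.\<close>

lemma row_Sigma:
  assumes X: "X \<in> ST" and i: "1 \<le> i" "i < n"
  shows "row (T (Sigma i) F) X = fscale (L.alpha X i) (row F X)
    + (if swap i X \<in> ST then rmat (swap i X) i (row F (swap i X)) else 0)"
proof -
  define g1 where "g1 Z = fscale (L.alpha Z i) (row F Z)" for Z
  define g2 where "g2 Z = rmat Z i (row F Z)" for Z
  have "row (T (Sigma i) F) X = (\<Sum>Z\<in>ST. fscale (bvec Z X) (g1 Z)) + (\<Sum>Z\<in>ST. fscale (std_vec n lam (swap i Z) X) (g2 Z))"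
    unfolding T_op.simps Let_def row_sum row_scale row_tens row_add row_def[of F, symmetric] sum.distrib[symmetric]
      g1_def g2_def rmat_def rop_def L.alpha_def
    by (intro sum.cong refl) (simp only: fun_vs.scale_scale mult.commute)
  also have "(\<Sum>Z\<in>ST. fscale (std_vec n lam (swap i Z) X) (g2 Z)) = (\<Sum>Z\<in>ST. if Z = swap i X then g2 (swap i X) else 0)"
    using X by (intro sum.cong refl) (auto simp: L.std_vec_apply)
  also have "\<dots> = (if swap i X \<in> ST then g2 (swap i X) else 0)"
    by (simp add: L.finite_std)
  finally show ?thesis
    unfolding sum_bvec[OF X] by (simp only: g1_def g2_def)
qed

lemma row_supported: "F \<in> supported (ST \<times> ST') \<Longrightarrow> row F X \<in> S'"
  by (auto simp: supported_def row_def)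

lemma row_eq_zero: "F \<in> supported (ST \<times> ST') \<Longrightarrow> X \<notin> ST \<Longrightarrow> row F X = 0"
  by (auto simp: supported_def row_def)

lemma linear_ops_T: "linear_ops T"
proof
  fix g c and F F' :: "'m filling \<times> 'm filling \<Rightarrow> 'k"
  have V_linear: "V' (Sigma i) (\<lambda>Y. F (X, Y) + F' (X, Y)) = V' (Sigma i) (\<lambda>Y. F (X, Y)) + V' (Sigma i) (\<lambda>Y. F' (X, Y))"
    "V' (Sigma i) (\<lambda>Y. F' (X, Y) + F (X, Y)) = V' (Sigma i) (\<lambda>Y. F' (X, Y)) + V' (Sigma i) (\<lambda>Y. F (X, Y))"
    "V' (Sigma i) (\<lambda>Y. c * F (X, Y)) = fscale c (V' (Sigma i) (\<lambda>Y. F (X, Y)))" for i X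
    using R.V.T_add[of "Sigma i" "\<lambda>Y. F (X, Y)" "\<lambda>Y. F' (X, Y)"]
      R.V.T_add[of "Sigma i" "\<lambda>Y. F' (X, Y)" "\<lambda>Y. F (X, Y)"] R.V.T_scale[of "Sigma i" c "\<lambda>Y. F (X, Y)"]
    by (simp_all only: plus_fun_def fscale_def)
  show "T g (F + F') = T g F + T g F'"
    by (cases g) (auto simp: fun_eq_iff sum_fun_apply fscale_def tens_def Let_def V_linear algebra_simps
        simp flip: sum.distrib simp del: V_op.simps intro!: sum.cong)
  show "T g (fscale c F) = fscale c (T g F)"
    by (cases g) (auto simp: fun_eq_iff sum_fun_apply fscale_def tens_def Let_def V_linear algebra_simps
        sum_distrib_left simp del: V_op.simps intro!: sum.cong)
qed

lemma T_supported:
  assumes g: "g \<in> hgens n" and F: "F \<in> supported (ST \<times> ST')"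
  shows "T g F \<in> supported (ST \<times> ST')"
proof -
  have "row (T g F) X \<in> S'" for X
  proof (cases "X \<in> ST")
    case False
    then show ?thesis by (simp add: row_outside fun_vs.subspace_0[OF subspace_supported])
  next
    case True
    show ?thesis
    proof (cases g)
      case Tau
      then show ?thesis
        using row_supported[OF F] by (simp only: row_Tau[OF True] fun_vs.subspace_scale[OF subspace_supported])
    next
      case (Sigma i)
      with g have i: "1 \<le> i" "i < n" by (auto simp: hgens_def)
      show ?thesis
        unfolding Sigma row_Sigma[OF True i]
        by (auto intro!: fun_vs.subspace_add fun_vs.subspace_scale subspace_supported row_supported[OF F]
            fun_vs.subspace_0 rop_supported[OF i] simp only: rmat_def split: if_splits)
    qed
  qed
  moreover have "row (T g F) X = 0" if "X \<notin> ST" for X using row_outside[OF that] .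
  ultimately show ?thesis
    by (auto simp: supported_def row_def fun_eq_iff)
qed

text \<open>After untwisting, the coefficient of the basis vector \<open>Y\<close> of the second
  factor, as a vector of the first. For \<open>Y\<close> in \<open>ST'\<close> these are the
  projections onto the copies.\<close>

definition column :: "'m filling \<Rightarrow> ('m filling \<times> 'm filling \<Rightarrow> 'k) \<Rightarrow> 'm filling \<Rightarrow> 'k" where
  "column Y F = (\<lambda>X. untwist X (row F X) Y)"

lemma column_add: "column Y (F + G) = column Y F + column Y G"
  and column_scale: "column Y (fscale c F) = fscale c (column Y F)"
  by (auto simp: column_def row_add row_scale untwist_add untwist_scale, simp add: fscale_def)

lemma linear_column: "Vector_Spaces.linear fscale fscale (column Y)"
  by unfold_locales (simp_all only: column_add column_scale)

lemma column_supported: "F \<in> supported (ST \<times> ST') \<Longrightarrow> column Y F \<in> supported ST"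
  by (simp add: supported_def[of ST] column_def row_eq_zero untwist_zero)

lemma column_T:
  assumes g: "g \<in> hgens n" and F: "F \<in> supported (ST \<times> ST')"
  shows "column Y (T g F) = L.V g (column Y F)"
proof
  fix X
  show "column Y (T g F) X = L.V g (column Y F) X"
  proof (cases "X \<in> ST")
    case False
    have "L.V g (column Y F) X = 0"
      using L.V_supported[OF g, of "column Y F"] False by (simp add: supported_def del: V_op.simps)
    then show ?thesis
      using False by (simp add: column_def row_outside untwist_zero del: V_op.simps)
  next
    case X: True
    show ?thesis
    proof (cases g)
      case Tau
      show ?thesis
        unfolding Tau L.V_Tau[OF column_supported[OF F]]
        unfolding column_def row_Tau[OF X] untwist_scale by (simp add: fscale_def)
    next
      case (Sigma i)
      with g have i: "1 \<le> i" "i < n" by (auto simp: hgens_def)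
      \<comment> \<open>\<open>untwist_swap\<close> is applied at \<open>swap i X\<close>, whose
        exchange is \<open>X\<close>; the operator on the incoming row becomes the scalar
        \<open>beta X i\<close>.\<close>
      have "untwist X (rmat (swap i X) i (row F (swap i X)))
          = fscale (coef_swap q v (nd X (i + 1)) (nd X i)) (untwist (swap i X) (row F (swap i X)))"
        if Z: "swap i X \<in> ST"
        using untwist_swap[OF Z i _ row_supported[OF F]] X unfolding L.swap_swap node_of_swap_std[OF X i] by simp
      then show ?thesis
        using X unfolding Sigma L.V_Sigma[OF i column_supported[OF F]]
        by (simp add: column_def row_Sigma[OF X i] untwist_add untwist_scale untwist_zero L.beta_def
            del: V_op.simps T_op.simps) (simp add: fscale_def)
    qed
  qed
qed

text \<open>Untwisted rows are supported on \<open>ST'\<close>, so these columns determine them, and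
  \<open>untwist X\<close> is injective on such rows.\<close>

lemma column_injective:
  assumes F: "F \<in> supported (ST \<times> ST')" and G: "G \<in> supported (ST \<times> ST')"
    and eq: "\<And>Y. Y \<in> ST' \<Longrightarrow> column Y F = column Y G"
  shows "F = G"
proof -
  have "row F X = row G X" for X
  proof -
    have "untwist X (row F X) = untwist X (row G X)"
    proof
      fix Y
      show "untwist X (row F X) Y = untwist X (row G X) Y"
      proof (cases "Y \<in> ST'")
        case True
        then show ?thesis using eq[OF True] by (auto simp: column_def fun_eq_iff)
      next
        case False
        then show ?thesis
          using untwist_supported[OF row_supported[OF F]] untwist_supported[OF row_supported[OF G]]
          by (simp add: supported_def)
      qed
    qed
    then show ?thesis
      using bij_untwist[of X] row_supported[OF F] row_supported[OF G] by (auto simp: bij_betw_def inj_on_def)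
  qed
  then show ?thesis by (auto simp: row_def fun_eq_iff)
qed

lemma free_act_column:
  assumes "x \<in> carrier (free_alg n)" "F \<in> supported (ST \<times> ST')"
  shows "column Y (free_act T x F) = free_act L.V x (column Y F)"
  using linear_ops_T L.linear_ops_V T_supported linear_column column_T assms by (rule free_act_intertwine)

lemma hecke_rep_T:
  assumes "1 \<le> n"
  shows "hecke_rep n q v (ST \<times> ST') T"
proof -
  interpret T: linear_ops T by (rule linear_ops_T)
  interpret V: hecke_rep n q v ST L.V by (rule L.hecke_rep_V[OF assms])
  show ?thesis
  proof
    fix x :: "'k freealg" and F :: "'m filling \<times> 'm filling \<Rightarrow> 'k"
    assume x: "x \<in> hecke_relators n q v" and F: "F \<in> supported (ST \<times> ST')"
    have x': "x \<in> carrier (free_alg n)" using x hecke_relators_closed by blast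
    have "foldr T ws F \<in> supported (ST \<times> ST')" if "set ws \<subseteq> hgens n" for ws
      using that by (induction ws) (auto simp: F T_supported simp del: T_op.simps)
    then have s: "free_act T x F \<in> supported (ST \<times> ST')"
      unfolding free_act_def using x'
      by (intro fun_vs.subspace_sum fun_vs.subspace_scale subspace_supported) (auto simp: free_alg_def)
    \<comment> \<open>Columns intertwine words in the generators before any relation is known for
      \<open>T\<close>, so a relator acts on each column as in \<open>L.V\<close>, by 0.\<close>
    have "column Y (free_act T x F) = column Y 0" for Y
      unfolding free_act_column[OF x' F] V.relators[OF x column_supported[OF F]]
      using column_scale[of Y 0 0] by simp
    then show "free_act T x F = 0"
      by (intro column_injective s fun_vs.subspace_0[OF subspace_supported])
  qed (use T_supported in auto)
qed

theorem hmod_iso_T_mod: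
  assumes "1 \<le> n"
  shows "hmod_iso n q v (T_mod n q v lam lam')
    (copies (fun_vs.dim (space (V_mod n q v lam'))) (V_mod n q v lam))"
proof -
  interpret V: hecke_rep n q v ST L.V by (rule L.hecke_rep_V[OF assms])
  interpret T: hecke_rep n q v "ST \<times> ST'" T by (rule hecke_rep_T[OF assms])
  define d where "d = card ST'"
  have d: "fun_vs.dim (space (V_mod n q v lam')) = d"
    by (simp add: V_mod_def d_def dim_supported R.finite_std)
  \<comment> \<open>The copies are numbered by the basis tableaux of the second factor.\<close>
  obtain e where e: "bij_betw e {..<d} ST'"
    using ex_bij_betw_nat_finite[OF R.finite_std] unfolding d_def atLeast0LessThan by blast
  define \<phi> where "\<phi> F = (\<lambda>(j, X). if j < d then column (e j) F X else 0)" for F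
  let ?S = "supported (ST \<times> ST') :: ('m filling \<times> 'm filling \<Rightarrow> 'k) set"
  let ?C = "{G. (\<forall>j<d. (\<lambda>X. G (j, X)) \<in> supported ST) \<and> (\<forall>j\<ge>d. \<forall>X. G (j, X) = 0)} :: (nat \<times> 'm filling \<Rightarrow> 'k) set"
  have spaces: "space (T_mod n q v lam lam') = ?S" "space (copies d (V_mod n q v lam)) = ?C"
    by (simp_all add: T_mod_def V_mod_def copies_def)
  have "bij_betw \<phi> ?S ?C"
    unfolding bij_betw_def
  proof (intro conjI subset_antisym)
    show "inj_on \<phi> ?S"
    proof (rule inj_onI, rule column_injective)
      fix F G Y assume eq: "\<phi> F = \<phi> G" and "Y \<in> ST'"
      then obtain j where "j < d" "Y = e j" using e by (auto simp: bij_betw_def)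
      then have "column Y F X = column Y G X" for X
        using fun_cong[OF eq, of "(j, X)"] by (simp add: \<phi>_def)
      then show "column Y F = column Y G" ..
    qed
    show "\<phi> ` ?S \<subseteq> ?C"
      using column_supported by (auto simp: \<phi>_def)
    show "?C \<subseteq> \<phi> ` ?S"
    proof
      fix G assume G: "G \<in> ?C"
      define e' where "e' = inv_into {..<d} e"
      have e': "e' (e j) = j" if "j < d" for j
        using e that by (simp add: e'_def bij_betw_def)
      \<comment> \<open>The untwisted row at \<open>X\<close> prescribed by \<open>G\<close>; a
        preimage of \<open>G\<close> arises by inverting \<open>untwist X\<close> row by
        row.\<close>
      define u where "u X = (\<lambda>Y. if Y \<in> ST' then G (e' Y, X) else 0)" for X
      have u: "u X \<in> S'" for X by (simp add: u_def supported_def)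
      define F where "F = (\<lambda>(X, Y). if X \<in> ST then inv_into S' (untwist X) (u X) Y else 0)"
      have inv: "inv_into S' (untwist X) (u X) \<in> S'" "untwist X (inv_into S' (untwist X) (u X)) = u X" for X
        using bij_untwist[of X] u[of X] by (auto simp: bij_betw_def inv_into_into f_inv_into_f)
      have F: "F \<in> ?S" using inv(1) by (auto simp: F_def supported_def)
      have row: "row F X = (if X \<in> ST then inv_into S' (untwist X) (u X) else 0)" for X
        by (auto simp: row_def F_def)
      have "G (j, X) = \<phi> F (j, X)" for j X
      proof (cases "j < d")
        case True
        then have "e j \<in> ST'" using e by (auto simp: bij_betw_def)
        moreover have "G (j, X) = 0" if "X \<notin> ST"
          using G True that by (auto simp: supported_def)
        moreover from calculation have "u X (e j) = G (j, X)" by (simp add: u_def e'[OF True])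
        ultimately show ?thesis
          using True by (simp add: \<phi>_def column_def row inv(2) untwist_zero)
      next
        case False
        then show ?thesis using G by (simp add: \<phi>_def)
      qed
      then have "G = \<phi> F" by (auto simp: fun_eq_iff)
      then show "G \<in> \<phi> ` ?S" using F by blast
    qed
  qed
  moreover have "\<phi> (F + G) = \<phi> F + \<phi> G" "\<phi> (fscale c F) = fscale c (\<phi> F)" for F G c
    by (simp_all add: \<phi>_def column_add column_scale fun_eq_iff) (simp add: fscale_def)
  moreover have "\<phi> (act (T_mod n q v lam lam') h F) = act (copies d (V_mod n q v lam)) h (\<phi> F)"
    if h: "h \<in> carrier (hecke n q v)" and F: "F \<in> ?S" for h F
  proof -
    obtain x where x: "x \<in> carrier (free_alg n)" "h = hecke_class n q v x"
      using h unfolding T.carrier_hecke by blast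
    have "column Y (act (T_mod n q v lam lam') h F) = act (V_mod n q v lam) h (column Y F)" for Y
      unfolding T_mod_def V_mod_def x(2)
      by (simp only: T.act_hecke_class[OF x(1) F] V.act_hecke_class[OF x(1) column_supported[OF F]]
          free_act_column[OF x(1) F])
    then show ?thesis
      by (auto simp: \<phi>_def copies_def fun_eq_iff)
  qed
  moreover have "is_hmod n q v (T_mod n q v lam lam')" "is_hmod n q v (copies d (V_mod n q v lam))"
    unfolding T_mod_def V_mod_def by (rule T.is_hmod_gen_hmod V.is_hmod_copies)+
  ultimately show ?thesis
    unfolding hmod_iso_def d spaces by blast
qed

end

section \<open>Indeterminate parameters\<close>

lemma single_variable_inject:
  "Poly_Mapping.single (Poly_Mapping.single j (1::nat)) (1::complex) = Poly_Mapping.single (Poly_Mapping.single k 1) 1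
    \<longleftrightarrow> j = k" (is "?l = ?r \<longleftrightarrow> _")
proof
  assume "?l = ?r"
  then have "Poly_Mapping.keys ?l = Poly_Mapping.keys ?r" by simp
  then have "Poly_Mapping.keys (Poly_Mapping.single j (1::nat)) = Poly_Mapping.keys (Poly_Mapping.single k (1::nat))"
    by simp
  then show "j = k" by simp
qed simp

text \<open>Everything is tested at \<open>q = 0\<close>: the sums have constant term 1 there, and
  an equality \<open>x ^ i * [:y j:] = [:y k:]\<close> would become \<open>y j = y k\<close> or
  \<open>0 = y k\<close>.\<close>

lemma admissible_indeterminates:
  "admissible n (indet_q :: 'm::{finite,linorder} ratfun) indet_v"
proof -
  define x :: "(('m \<Rightarrow>\<^sub>0 nat) \<Rightarrow>\<^sub>0 complex) poly" where "x = [:0, 1:]"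
  define y :: "'m \<Rightarrow> ('m \<Rightarrow>\<^sub>0 nat) \<Rightarrow>\<^sub>0 complex" where "y j = Poly_Mapping.single (Poly_Mapping.single j 1) 1" for j
  have q: "indet_q = to_fract x" and v: "indet_v j = to_fract [:y j:]" for j
    by (simp_all add: indet_q_def indet_v_def x_def y_def to_fract_def)
  have power: "to_fract x ^ k = to_fract (x ^ k)" for k
    by (induction k) simp_all
  have x: "x \<noteq> 0" by (simp add: x_def)
  have x0: "poly x 0 = 0" by (simp add: x_def)
  have y0: "y j \<noteq> 0" for j
  proof -
    have "Poly_Mapping.lookup (y j) (Poly_Mapping.single j 1) = 1" by (simp add: y_def)
    then show ?thesis by auto
  qed
  have y_inj: "y j = y k \<longleftrightarrow> j = k" for j k
    unfolding y_def by (rule single_variable_inject)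
  have ne: "x ^ i * [:y j:] \<noteq> [:y k:]" if "j \<noteq> k" for i j k
  proof
    assume "x ^ i * [:y j:] = [:y k:]"
    then have "poly (x ^ i * [:y j:]) 0 = poly [:y k:] 0" by simp
    then show False using that y_inj y0 by (cases i) (auto simp: x0 poly_power)
  qed
  have "(\<Sum>i\<le>N. indet_q ^ (2 * i) :: 'm ratfun) \<noteq> 0" for N
  proof -
    have "poly (\<Sum>i\<le>N. x ^ (2 * i)) 0 = (\<Sum>i\<le>N. if i = 0 then 1 else 0)"
      by (simp add: poly_sum poly_power x0 power_0_left)
    then have "(\<Sum>i\<le>N. x ^ (2 * i)) \<noteq> 0" by auto
    then show ?thesis unfolding q power to_fract_sum[symmetric] to_fract_eq_0_iff .
  qed
  moreover have "(indet_q :: 'm ratfun) powi (2 * i) * indet_v j - indet_v k \<noteq> 0" if "j \<noteq> k" for i j k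
  proof (cases "i \<ge> 0")
    case True
    then have "to_fract x powi (2 * i) = to_fract (x ^ nat (2 * i))"
      by (simp add: power_int_def power)
    then show ?thesis
      using ne[OF that] unfolding q v by (simp only: right_minus_eq to_fract_mult[symmetric] to_fract_eq_iff simp_thms)
  next
    case False
    let ?z = "to_fract (x ^ nat (- 2 * i))"
    from False have "to_fract x powi (2 * i) = inverse ?z"
      by (simp add: power_int_def power power_inverse)
    moreover have "?z \<noteq> 0" unfolding to_fract_eq_0_iff using x by simp
    then have "inverse ?z * a = b \<longleftrightarrow> a = ?z * b" for a b
      by (auto simp: field_simps)
    \<comment> \<open>For negative exponents the power is moved to the other side, which exchanges
      \<open>j\<close> and \<open>k\<close> in \<open>ne\<close>.\<close>
    moreover have "[:y j:] \<noteq> x ^ nat (- 2 * i) * [:y k:]"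
      using ne[of k j "nat (- 2 * i)"] that by metis
    ultimately show ?thesis
      unfolding q v by (simp only: right_minus_eq to_fract_mult[symmetric] to_fract_eq_iff simp_thms)
  qed
  moreover have "(indet_q :: 'm ratfun) \<noteq> 0" "indet_v j \<noteq> (0 :: 'm ratfun)" for j
    unfolding q v using x y0 by simp_all
  ultimately show ?thesis by (simp add: admissible_def)
qed

lemma seminormal_pair_mpartitions:
  assumes "admissible n q v" "is_mpartition n lam" "is_mpartition n lam'"
  shows "seminormal_pair n lam lam' q v"
  using assms by unfold_locales (auto simp: is_mpartition_def)

theorem proposition16:
  fixes n :: nat and lam lam' :: "'m::{finite,linorder} \<Rightarrow> nat list"
  assumes "n \<ge> 1" and "is_mpartition n lam" and "is_mpartition n lam'"
  shows
    "hmod_iso n (indet_q :: 'm ratfun) indet_v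
       (T_mod n indet_q indet_v lam lam')
       (copies (fun_vs.dim (space (V_mod n (indet_q :: 'm ratfun) indet_v lam')))
          (V_mod n indet_q indet_v lam))
     \<and>
     (\<forall>(q::complex) (v :: 'm \<Rightarrow> complex). admissible n q v \<longrightarrow>
        hmod_iso n q v
          (T_mod n q v lam lam')
          (copies (fun_vs.dim (space (V_mod n q v lam'))) (V_mod n q v lam)))"
  using assms admissible_indeterminates
  by (blast intro: seminormal_pair.hmod_iso_T_mod seminormal_pair_mpartitions)

end
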